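(* Let $\hat{A}\in\mathbb{DC}_n^{\mathrm{CM}}$ with $r=\operatorname{Rank}(\hat{A})$. Then there exist $\hat{U}\in\mathbb{DC}_n^{U}$, $K\in\mathbb{DC}^{r\times r}$ invertible and $L\in\mathbb{DC}^{r\times(n-r)}$ satisfying $KK^*+LL^*=I_r$, and $\Sigma_1=\operatorname{diag}(\mu_1,\ldots,\mu_r)$ with $\mu_1\ge\cdots\ge\mu_r$ positive appreciable dual numbers, such that $\hat A=\hat U\begin{bmatrix}\Sigma_1K&\Sigma_1L\\0&0\end{bmatrix}\hat U^*$ and $$\hat{A}^{\mathrm{core}}=\hat{U}\begin{bmatrix}K^{-1}\Sigma_1^{-1}&0\\0&0\end{bmatrix}\hat{U}^*.$$
   Context: Dual complex numbers are $\hat a=a_s+\epsilon a_d$ with $a_s,a_d\in\mathbb{C}$, $\epsilon\ne0$, $\epsilon^2=0$, $\epsilon$ commuting with scalars; they form the ring $\mathbb{DC}$. A dual number is such an element with $a_s,a_d\in\mathbb{R}$. It is appreciable if $a_s\neq0$ and infinitesimal if $a_s=0$. Dual numbers are totally ordered by: $\hat a\le\hat b$ iff $a_s<b_s$, or $a_s=b_s$ and $a_d\le b_d$; $\hat a$ is positive if $\hat a>0$. A matrix $\hat A\in\mathbb{DC}^{m\times n}$ is written $\hat A=A_s+\epsilon A_d$ with $A_s,A_d\in\mathbb{C}^{m\times n}$; $\hat A^*=A_s^*+\epsilon A_d^*$. $\mathbb{DC}_n^U$ is the set of $\hat U\in\mathbb{DC}^{n\times n}$ with $\hat U^{-1}=\hat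 U^*$. Dual SVD: every $\hat A\in\mathbb{DC}^{m\times n}$ can be written $\hat A=\hat P\begin{bmatrix}\Sigma_0&0\\0&0\end{bmatrix}\hat V^*$ with $\hat P\in\mathbb{DC}_m^U$, $\hat V\in\mathbb{DC}_n^U$, $\Sigma_0=\operatorname{diag}(\mu_1,\ldots,\mu_t)$ with positive dual number entries in nonincreasing order (appreciable ones first, then infinitesimal ones), where $\Sigma_0$ is uniquely determined by $\hat A$; $\operatorname{Rank}(\hat A)=t$. $\mathbb{DC}_n^{\mathrm{CM}}=\{\hat A\in\mathbb{DC}^{n\times n}:\mathcal R(\hat A^2)=\mathcal R(\hat A)\}$, where $\mathcal R(\hat A)=\{\hat Ax:x\in\mathbb{DC}^n\}$. For $\hat A\in\mathbb{DC}_n^{\mathrm{CM}}$ the dual core generalized inverse (DCGI) $\hat A^{\mathrm{core}}$ is the unique $\hat X$ with $\hat A\hat X\hat A=\hat A$, $\hat A\hat X^2=\hat X$, $(\hat A\hat X)^*=\hat A\hat X$. *)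

theory Defs
  imports
    "HOL.Complex"
    "Jordan_Normal_Form.Matrix"
    "Jordan_Normal_Form.Conjugate"
begin

section \<open>Dual complex numbers\<close>

text \<open>\<open>DC a b\<close> is $a + \epsilon b$.\<close>

datatype dual_complex = DC (std_part: complex) (dual_part: complex)

instantiation dual_complex :: comm_ring_1
begin

definition "0 = DC 0 0"
definition "1 = DC 1 0"
definition "x + y = DC (std_part x + std_part y) (dual_part x + dual_part y)"
definition "- x = DC (- std_part x) (- dual_part x)"
definition "x - y = DC (std_part x - std_part y) (dual_part x - dual_part y)"
definition "x * y =
  DC (std_part x * std_part y) (std_part x * dual_part y + dual_part x * std_part y)"

instance
  by standard
    (simp_all add: zero_dual_complex_def one_dual_complex_def plus_dual_complex_def
      uminus_dual_complex_def minus_dual_complex_def times_dual_complex_def algebra_simps)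

end

instantiation dual_complex :: conjugatable_ring
begin

definition "conjugate x = DC (cnj (std_part x)) (cnj (dual_part x))"

instance
  by standard
    (auto simp: conjugate_dual_complex_def zero_dual_complex_def plus_dual_complex_def
      uminus_dual_complex_def times_dual_complex_def intro: dual_complex.expand)

end

definition dual_number :: "dual_complex \<Rightarrow> bool" where
  "dual_number x \<longleftrightarrow> std_part x \<in> \<real> \<and> dual_part x \<in> \<real>"

definition appreciable :: "dual_complex \<Rightarrow> bool" where
  "appreciable x \<longleftrightarrow> std_part x \<noteq> 0"

text \<open>The total order on dual numbers; only meaningful for arguments satisfying
  \<^const>\<open>dual_number\<close>.\<close>

definition dual_le :: "dual_complex \<Rightarrow> dual_complex \<Rightarrow> bool" where
  "dual_le x y \<longleftrightarrow> Re (std_part x) < Re (std_part y) \<or>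
     Re (std_part x) = Re (std_part y) \<and> Re (dual_part x) \<le> Re (dual_part y)"

definition dual_positive :: "dual_complex \<Rightarrow> bool" where
  "dual_positive x \<longleftrightarrow> dual_number x \<and> dual_le 0 x \<and> x \<noteq> 0"


section \<open>Dual complex matrices\<close>

text \<open>Entrywise, \<^const>\<open>conjugate\<close> acts on both parts, so this is
  $A_s^* + \epsilon A_d^*$. (The constant \<open>mat_adjoint\<close> requires entries in a field.)\<close>

definition conj_transpose :: "dual_complex mat \<Rightarrow> dual_complex mat" where
  "conj_transpose A = transpose_mat (map_mat conjugate A)"

definition mat_inv :: "dual_complex mat \<Rightarrow> dual_complex mat" where
  "mat_inv A = (THE B. inverts_mat A B \<and> inverts_mat B A)"

definition DC_unitary :: "nat \<Rightarrow> dual_complex mat set" where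
  "DC_unitary n = {U \<in> carrier_mat n n.
     inverts_mat U (conj_transpose U) \<and> inverts_mat (conj_transpose U) U}"

definition nonincreasing_duals :: "nat \<Rightarrow> (nat \<Rightarrow> dual_complex) \<Rightarrow> bool" where
  "nonincreasing_duals t \<mu> \<longleftrightarrow> (\<forall>i j. i \<le> j \<and> j < t \<longrightarrow> dual_le (\<mu> j) (\<mu> i))"

text \<open>The singular values are $\mu_0 \geq \dots \geq \mu_{t-1}$, indexed from 0.\<close>

definition dual_SVD ::
  "dual_complex mat \<Rightarrow> nat \<Rightarrow> (nat \<Rightarrow> dual_complex) \<Rightarrow> dual_complex mat \<Rightarrow> dual_complex mat \<Rightarrow> bool"
where
  "dual_SVD A t \<mu> P V \<longleftrightarrow>
     (let m = dim_row A; n = dim_col A in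
        t \<le> m \<and> t \<le> n \<and> P \<in> DC_unitary m \<and> V \<in> DC_unitary n \<and>
        (\<forall>i<t. dual_positive (\<mu> i)) \<and> nonincreasing_duals t \<mu> \<and>
        A = P * four_block_mat (mat_diag t \<mu>) (0\<^sub>m t (n - t))
                               (0\<^sub>m (m - t) t) (0\<^sub>m (m - t) (n - t)) * conj_transpose V)"

definition dual_rank :: "dual_complex mat \<Rightarrow> nat" where
  "dual_rank A = (THE t. \<exists>\<mu> P V. dual_SVD A t \<mu> P V)"

definition range_mat :: "dual_complex mat \<Rightarrow> dual_complex vec set" where
  "range_mat A = {A *\<^sub>v x | x. x \<in> carrier_vec (dim_col A)}"

definition DC_CM :: "nat \<Rightarrow> dual_complex mat set" where
  "DC_CM n = {A \<in> carrier_mat n n. range_mat (A ^\<^sub>m 2) = range_mat A}"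

definition is_core_inverse :: "dual_complex mat \<Rightarrow> dual_complex mat \<Rightarrow> bool" where
  "is_core_inverse A X \<longleftrightarrow> X \<in> carrier_mat (dim_row A) (dim_row A) \<and>
     A * X * A = A \<and> A * X ^\<^sub>m 2 = X \<and> conj_transpose (A * X) = A * X"

definition core_inverse :: "dual_complex mat \<Rightarrow> dual_complex mat" where
  "core_inverse A = (THE X. is_core_inverse A X)"

end

theory Submission
  imports Defs "Jordan_Normal_Form.Schur_Decomposition" "Jordan_Normal_Form.Spectral_Radius"
begin

text \<open>A dual Hermitian matrix is unitarily diagonalizable: diagonalize the standard part, remove
  the entries of the dual part between different eigenspaces by first-order perturbation, and
  diagonalize what remains inside each eigenspace. Applied to $A A^*$ this gives the dual SVD
  $A = P \,\mathrm{diag}(\Sigma, 0)\, V^*$. Since $A = A^2 Y$, comparing the leading blocks of both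
  sides gives an identity $I_t = N \,\mathrm{diag}(\sigma)\, Z$ for the standard parts $\sigma$ of the
  singular values, so no singular value is infinitesimal. Then $U = P$ works, with $[K\; L]$ the
  upper rows of the unitary matrix $V^* P$.\<close>

section \<open>Conjugate transposes and unitary matrices\<close>

text \<open>An infinitesimal singular value squares to zero, so A A^* cannot see it: an eigenvalue
  of A A^* with zero standard part still allows the matching row of P^* A to have a nonzero dual
  part. Existence of the decomposition is therefore proved together with a factorization A = A^2 Y,
  which forces such rows to vanish. Rank and core inverse are definite descriptions. For the rank,
  all decompositions of A must agree on t, so appreciability is shown for an arbitrary one, and
  complex standard parts then decide t. For the core inverse, the explicit X supplies A = X A^2,
  which yields the left cancellation. Zero divisors are the recurring obstacle: field arguments are
  applied to standard parts only, or replaced by adjugates. The inverse of K comes from the same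
  comparison of leading blocks, kept over the dual complex numbers.\<close>

lemma mult_mat_assoc:
  fixes A B C :: "'a::semiring_0 mat"
  assumes "dim_col A = dim_row B" "dim_col B = dim_row C"
  shows "A * B * C = A * (B * C)"
  by (rule assoc_mult_mat[of _ "dim_row A" "dim_row B" _ "dim_row C" _ "dim_col C"])
    (use assms in auto)

lemma mult_one_left [simp]:
  fixes A :: "'a::semiring_1 mat"
  shows "dim_row A = n \<Longrightarrow> 1\<^sub>m n * A = A"
  by (rule left_mult_one_mat[of _ _ "dim_col A"]) auto

lemma mult_one_right [simp]:
  fixes A :: "'a::semiring_1 mat"
  shows "dim_col A = n \<Longrightarrow> A * 1\<^sub>m n = A"
  by (rule right_mult_one_mat[of _ "dim_row A"]) auto

text \<open>Products are kept right-nested by \<open>mult_mat_assoc\<close>; this form cancels an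
  inverse pair at the head of such a nest, where \<open>A * B\<close> itself no longer
  occurs.\<close>

lemma mult_cancel_inverse:
  fixes A B X :: "'a::semiring_1 mat"
  assumes "A * B = 1\<^sub>m n" "dim_col A = dim_row B" "dim_col B = dim_row X"
  shows "A * (B * X) = X"
proof -
  have "dim_row X = n" using assms by (metis index_mult_mat(3) index_one_mat(3))
  then show ?thesis using assms by (simp flip: mult_mat_assoc)
qed

lemma index_mult_mat_sum:
  assumes "i < dim_row A" "j < dim_col B" "dim_col A = dim_row B"
  shows "(A * B) $$ (i, j) = (\<Sum>l<dim_row B. A $$ (i, l) * B $$ (l, j))"
  using assms by (simp add: scalar_prod_def lessThan_atLeast0)

lemma mat_diag_index [simp]:
  "i < n \<Longrightarrow> j < n \<Longrightarrow> mat_diag n f $$ (i, j) = (if i = j then f j else 0)"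
  "dim_row (mat_diag n f) = n" "dim_col (mat_diag n f) = n"
  by (simp_all add: mat_diag_def)

lemma diag_mult_index:
  assumes "i < n" "j < dim_col A" "dim_row A = n"
  shows "(mat_diag n f * A) $$ (i, j) = f i * A $$ (i, j)"
  using assms by (subst mat_diag_mult_left[of _ _ "dim_col A"]) auto

lemma mult_diag_index:
  assumes "j < n" "i < dim_row A" "dim_col A = n"
  shows "(A * mat_diag n f) $$ (i, j) = A $$ (i, j) * f j"
  using assms by (subst mat_diag_mult_right[of _ "dim_row A"]) auto

lemma mat_diag_cong: "(\<And>i. i < n \<Longrightarrow> f i = g i) \<Longrightarrow> mat_diag n f = mat_diag n g"
  by (rule eq_matI) auto

lemma conjugate_one [simp]: "conjugate (1 :: 'a::{conjugatable_ring,comm_ring_1}) = 1"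
  by (metis conjugate_dist_mul conjugate_id mult.left_neutral mult.right_neutral)

text \<open>Typed over any conjugatable ring, so that one set of rules serves complex and dual
  complex matrices; \<open>conj_transpose\<close> is the dual complex instance.\<close>

definition dagger :: "'a::conjugatable_ring mat \<Rightarrow> 'a mat" where
  "dagger A = transpose_mat (map_mat conjugate A)"

lemma conj_transpose_dagger: "conj_transpose A = dagger A"
  by (simp add: conj_transpose_def dagger_def)

lemma dagger_dim [simp]: "dim_row (dagger A) = dim_col A" "dim_col (dagger A) = dim_row A"
  by (simp_all add: dagger_def)

lemma dagger_carrier [intro]: "A \<in> carrier_mat n m \<Longrightarrow> dagger A \<in> carrier_mat m n"
  by auto

lemma dagger_index [simp]:
  "i < dim_col A \<Longrightarrow> j < dim_row A \<Longrightarrow> dagger A $$ (i, j) = conjugate (A $$ (j, i))"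
  by (simp add: dagger_def)

lemma dagger_dagger [simp]: "dagger (dagger A) = A"
  by (rule eq_matI) auto

lemma dagger_mult:
  fixes A B :: "'a::{conjugatable_ring,comm_ring_1} mat"
  assumes "dim_col A = dim_row B"
  shows "dagger (A * B) = dagger B * dagger A"
  by (rule eq_matI)
    (use assms in \<open>auto simp: index_mult_mat_sum sum_conjugate conjugate_dist_mul mult.commute
       simp del: index_mult_mat(1)\<close>)

lemma dagger_zero [simp]: "dagger (0\<^sub>m n m) = 0\<^sub>m m n"
  by (rule eq_matI) auto

lemma dagger_one [simp]: "dagger (1\<^sub>m n :: 'a::{conjugatable_ring,comm_ring_1} mat) = 1\<^sub>m n"
  by (rule eq_matI) auto

lemma dagger_mat_diag [simp]: "dagger (mat_diag n f) = mat_diag n (\<lambda>i. conjugate (f i))"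
  by (rule eq_matI) auto

lemma dagger_four_block:
  assumes "A \<in> carrier_mat a c" "B \<in> carrier_mat a d" "C \<in> carrier_mat b c" "D \<in> carrier_mat b d"
  shows "dagger (four_block_mat A B C D) = four_block_mat (dagger A) (dagger C) (dagger B) (dagger D)"
  unfolding dagger_def
  by (subst map_four_block_mat[OF assms]) (rule transpose_four_block_mat, use assms in auto)

definition unitary_mat :: "nat \<Rightarrow> 'a::{conjugatable_ring,comm_ring_1} mat \<Rightarrow> bool" where
  "unitary_mat n U \<longleftrightarrow> U \<in> carrier_mat n n \<and> U * dagger U = 1\<^sub>m n \<and> dagger U * U = 1\<^sub>m n"

lemma DC_unitary_iff: "U \<in> DC_unitary n \<longleftrightarrow> unitary_mat n U"
  by (auto simp: DC_unitary_def unitary_mat_def inverts_mat_def conj_transpose_dagger)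

lemma unitary_matD:
  assumes "unitary_mat n U"
  shows "dim_row U = n" "dim_col U = n" "U * dagger U = 1\<^sub>m n" "dagger U * U = 1\<^sub>m n"
    "dim_row X = n \<Longrightarrow> U * (dagger U * X) = X" "dim_row X = n \<Longrightarrow> dagger U * (U * X) = X"
  using assms by (auto simp: unitary_mat_def intro!: mult_cancel_inverse)

lemma unitary_dagger: "unitary_mat n U \<Longrightarrow> unitary_mat n (dagger U)"
  by (auto simp: unitary_mat_def)

lemma unitary_mult:
  assumes "unitary_mat n U" "unitary_mat n V"
  shows "unitary_mat n (U * V)"
  using unitary_matD[OF assms(1)] unitary_matD[OF assms(2)]
  by (auto simp: unitary_mat_def dagger_mult mult_mat_assoc)

lemma unitary_one: "unitary_mat n (1\<^sub>m n)"
  by (simp add: unitary_mat_def)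

lemma unitary_block_diag:
  assumes "unitary_mat k U" "unitary_mat m V"
  shows "unitary_mat (k + m) (four_block_mat U (0\<^sub>m k m) (0\<^sub>m m k) V)"
proof -
  note U = unitary_matD[OF assms(1)] and V = unitary_matD[OF assms(2)]
  have c: "U \<in> carrier_mat k k" "V \<in> carrier_mat m m"
    using assms by (auto simp: unitary_mat_def)
  have d: "dagger (four_block_mat U (0\<^sub>m k m) (0\<^sub>m m k) V)
      = four_block_mat (dagger U) (0\<^sub>m k m) (0\<^sub>m m k) (dagger V)"
    by (subst dagger_four_block[of _ k k _ m _ m]) (use c in auto)
  have c': "dagger U \<in> carrier_mat k k" "dagger V \<in> carrier_mat m m" using c by auto
  show ?thesis
    unfolding unitary_mat_def d
    using c c' U V
    by (auto simp: mult_four_block_mat[OF c(1) _ _ c(2) c'(1) _ _ c'(2)]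
        mult_four_block_mat[OF c'(1) _ _ c'(2) c(1) _ _ c(2)] four_block_one_mat)
qed

lemma four_block_diag_diag:
  "four_block_mat (mat_diag k f) (0\<^sub>m k m) (0\<^sub>m m k) (mat_diag m g)
    = mat_diag (k + m) (\<lambda>i. if i < k then f i else g (i - k))"
  by (rule eq_matI) auto

lemma index_mult_dagger:
  assumes "X \<in> carrier_mat r n"
  shows "i < r \<Longrightarrow> j < r \<Longrightarrow> (X * dagger X) $$ (i, j) = (\<Sum>l<n. X $$ (i, l) * conjugate (X $$ (j, l)))"
  using assms by (subst index_mult_mat_sum) auto

section \<open>Dual complex matrices as pairs of complex matrices\<close>

definition dmat :: "complex mat \<Rightarrow> complex mat \<Rightarrow> dual_complex mat" where
  "dmat X Y = mat (dim_row X) (dim_col X) (\<lambda>(i, j). DC (X $$ (i, j)) (Y $$ (i, j)))"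

lemma dmat_dim [simp]: "dim_row (dmat X Y) = dim_row X" "dim_col (dmat X Y) = dim_col X"
  by (simp_all add: dmat_def)

lemma dmat_index [simp]:
  "i < dim_row X \<Longrightarrow> j < dim_col X \<Longrightarrow> dmat X Y $$ (i, j) = DC (X $$ (i, j)) (Y $$ (i, j))"
  by (simp add: dmat_def)

definition std_mat :: "dual_complex mat \<Rightarrow> complex mat" where
  "std_mat A = map_mat std_part A"

definition dual_mat :: "dual_complex mat \<Rightarrow> complex mat" where
  "dual_mat A = map_mat dual_part A"

lemma std_dual_mat_simps [simp]:
  "dim_row (std_mat A) = dim_row A" "dim_col (std_mat A) = dim_col A"
  "dim_row (dual_mat A) = dim_row A" "dim_col (dual_mat A) = dim_col A"
  "i < dim_row A \<Longrightarrow> j < dim_col A \<Longrightarrow> std_mat A $$ (i, j) = std_part (A $$ (i, j))"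
  "i < dim_row A \<Longrightarrow> j < dim_col A \<Longrightarrow> dual_mat A $$ (i, j) = dual_part (A $$ (i, j))"
  by (simp_all add: std_mat_def dual_mat_def)

lemma dmat_std_dual: "dmat (std_mat A) (dual_mat A) = A"
  by (rule eq_matI) auto

lemma std_mat_dmat [simp]: "std_mat (dmat X Y) = X"
  by (rule eq_matI) auto

lemma dual_mat_dmat [simp]:
  "dim_row Y = dim_row X \<Longrightarrow> dim_col Y = dim_col X \<Longrightarrow> dual_mat (dmat X Y) = Y"
  by (rule eq_matI) auto

lemma std_dual_part_simps [simp]:
  "std_part 0 = 0" "dual_part 0 = 0" "std_part 1 = 1" "dual_part 1 = 0"
  "std_part (x + y) = std_part x + std_part y" "dual_part (x + y) = dual_part x + dual_part y"
  "std_part (x - y) = std_part x - std_part y" "dual_part (x - y) = dual_part x - dual_part y"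
  "std_part (- x) = - std_part x" "dual_part (- x) = - dual_part x"
  "std_part (x * y) = std_part x * std_part y"
  "dual_part (x * y) = std_part x * dual_part y + dual_part x * std_part y"
  "std_part (conjugate x) = cnj (std_part x)" "dual_part (conjugate x) = cnj (dual_part x)"
  by (simp_all add: zero_dual_complex_def one_dual_complex_def plus_dual_complex_def
      uminus_dual_complex_def minus_dual_complex_def times_dual_complex_def
      conjugate_dual_complex_def)

lemma std_dual_part_sum:
  "std_part (sum f I) = (\<Sum>i\<in>I. std_part (f i))" "dual_part (sum f I) = (\<Sum>i\<in>I. dual_part (f i))"
  by (induction I rule: infinite_finite_induct) auto

lemma std_mat_mult:
  "dim_col A = dim_row B \<Longrightarrow> std_mat (A * B) = std_mat A * std_mat B"
  by (rule eq_matI)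
    (auto simp: index_mult_mat_sum std_dual_part_sum simp del: index_mult_mat(1))

text \<open>Leibniz rule: the product of the two dual parts carries the square of epsilon. With
  \<open>std_mat_mult\<close> and \<open>dual_mat_eqI\<close> it turns a dual identity into two
  complex ones.\<close>

lemma dual_mat_mult:
  "dim_col A = dim_row B \<Longrightarrow> dual_mat (A * B) = std_mat A * dual_mat B + dual_mat A * std_mat B"
  by (rule eq_matI)
    (auto simp: index_mult_mat_sum std_dual_part_sum sum.distrib simp del: index_mult_mat(1))

lemma std_mat_dagger: "std_mat (dagger A) = dagger (std_mat A)"
  by (rule eq_matI) auto

lemma dual_mat_dagger: "dual_mat (dagger A) = dagger (dual_mat A)"
  by (rule eq_matI) auto

lemma std_mat_one [simp]: "std_mat (1\<^sub>m n) = 1\<^sub>m n" and dual_mat_one [simp]: "dual_mat (1\<^sub>m n) = 0\<^sub>m n n"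
  by (rule eq_matI; auto)+

lemma std_mat_diag [simp]: "std_mat (mat_diag n f) = mat_diag n (\<lambda>i. std_part (f i))"
  and dual_mat_diag [simp]: "dual_mat (mat_diag n f) = mat_diag n (\<lambda>i. dual_part (f i))"
  by (rule eq_matI; auto)+

lemma dual_mat_eqI: "std_mat A = std_mat B \<Longrightarrow> dual_mat A = dual_mat B \<Longrightarrow> A = B"
  by (metis dmat_std_dual)

lemma dmat_mult:
  assumes "dim_col X = dim_row X'" "dim_row Y = dim_row X" "dim_col Y = dim_col X"
    "dim_row Y' = dim_row X'" "dim_col Y' = dim_col X'"
  shows "dmat X Y * dmat X' Y' = dmat (X * X') (X * Y' + Y * X')"
  using assms by (intro dual_mat_eqI) (simp_all add: std_mat_mult dual_mat_mult)

lemma dagger_dmat: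
  assumes "dim_row Y = dim_row X" "dim_col Y = dim_col X"
  shows "dagger (dmat X Y) = dmat (dagger X) (dagger Y)"
  using assms by (intro dual_mat_eqI) (simp_all add: std_mat_dagger dual_mat_dagger)

lemma dmat_one: "dmat (1\<^sub>m n) (0\<^sub>m n n) = 1\<^sub>m n"
  by (intro dual_mat_eqI) simp_all

lemma unitary_std_mat: "unitary_mat n U \<Longrightarrow> unitary_mat n (std_mat U)"
  unfolding unitary_mat_def
  by (metis carrier_matD carrier_matI dagger_dim std_dual_mat_simps(1,2) std_mat_dagger std_mat_mult
      std_mat_one)

lemma unitary_dmat_zero:
  assumes "unitary_mat n W"
  shows "unitary_mat n (dmat W (0\<^sub>m n n))"
proof -
  have [simp]: "dim_row W = n" "dim_col W = n" "W * dagger W = 1\<^sub>m n" "dagger W * W = 1\<^sub>m n"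
    using unitary_matD(1-4)[OF assms] by auto
  show ?thesis
    by (auto simp: unitary_mat_def dagger_dmat dmat_mult dmat_one left_mult_zero_mat' right_mult_zero_mat')
qed

section \<open>Hermitian diagonalization over the complex numbers\<close>

text \<open>Column \<open>i\<close> of \<open>U\<close> is an eigenvector; it is nonzero because
  \<open>dagger U\<close> sends it to a unit vector.\<close>

lemma diagonalization_eigenvalue:
  fixes H :: "complex mat"
  assumes U: "unitary_mat n U" and H: "H = U * mat_diag n f * dagger U" and i: "i < n"
  shows "eigenvalue H (f i)"
proof -
  note [simp] = unitary_matD(1-4)[OF U]
  have c: "U \<in> carrier_mat n n" using U by (simp add: unitary_mat_def)
  have Hc: "H \<in> carrier_mat n n" using H by auto
  have HU: "H * U = U * mat_diag n f" using H by (simp add: mult_mat_assoc)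
  have "H *\<^sub>v col U i = col (H * U) i"
    using col_mult2[OF Hc c i] by simp
  also have "\<dots> = f i \<cdot>\<^sub>v col U i"
    unfolding HU using i by (intro eq_vecI) (auto simp: mult_diag_index simp del: index_mult_mat(1))
  finally have ev: "H *\<^sub>v col U i = f i \<cdot>\<^sub>v col U i" .
  have "dagger U *\<^sub>v col U i = unit_vec n i"
    using col_mult2[OF dagger_carrier[OF c] c i] i by simp
  moreover have "dagger U *\<^sub>v 0\<^sub>v n = 0\<^sub>v n"
    using c by (intro eq_vecI) (simp_all add: scalar_prod_def)
  ultimately have nz: "col U i \<noteq> 0\<^sub>v n"
    using i by (metis index_unit_vec(1) index_zero_vec(1) zero_neq_one)
  have "col U i \<in> carrier_vec n" using c i by (simp add: col_carrier_vec)
  then show ?thesis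
    unfolding eigenvalue_def eigenvector_def carrier_matD(1)[OF Hc] using ev nz by blast
qed

lemma eigenvalue_mat_diag:
  assumes "eigenvalue (mat_diag n d) (e :: complex)"
  shows "e \<in> d ` {..<n}"
proof -
  obtain v where v: "v \<in> carrier_vec n" "v \<noteq> 0\<^sub>v n" "mat_diag n d *\<^sub>v v = e \<cdot>\<^sub>v v"
    using assms by (auto simp: eigenvalue_def eigenvector_def)
  then obtain i where i: "i < n" "v $ i \<noteq> 0"
    by (metis carrier_vecD eq_vecI index_zero_vec)
  have "(mat_diag n d *\<^sub>v v) $ i = (\<Sum>l\<in>{0..<n}. row (mat_diag n d) i $ l * v $ l)"
    using v(1) i by (simp add: scalar_prod_def)
  also have "\<dots> = (\<Sum>l\<in>{0..<n}. if l = i then d l * v $ l else 0)"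
    using i by (intro sum.cong) auto
  also have "\<dots> = d i * v $ i"
    using i by simp
  finally show ?thesis using v i by auto
qed

lemma unitary_conj_decomp:
  assumes W: "unitary_mat n W" and dims: "H \<in> carrier_mat n n" "D \<in> carrier_mat n n" "F \<in> carrier_mat n n"
    and eq: "dagger W * H * W = F * D * dagger F"
  shows "H = (W * F) * D * dagger (W * F)"
proof -
  note [simp] = unitary_matD[OF W]
  have "H = W * (dagger W * H * W) * dagger W"
    using dims by (simp add: mult_mat_assoc)
  also have "\<dots> = (W * F) * D * dagger (W * F)"
    unfolding eq using dims by (simp add: mult_mat_assoc dagger_mult)
  finally show ?thesis .
qed

lemma block_diag_conj:
  fixes U :: "'a::{conjugatable_ring,comm_ring_1} mat"
  assumes c: "U \<in> carrier_mat k k" "V \<in> carrier_mat m m" "A \<in> carrier_mat k k" "B \<in> carrier_mat m m"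
  shows "four_block_mat U (0\<^sub>m k m) (0\<^sub>m m k) V * four_block_mat A (0\<^sub>m k m) (0\<^sub>m m k) B
      * dagger (four_block_mat U (0\<^sub>m k m) (0\<^sub>m m k) V)
    = four_block_mat (U * A * dagger U) (0\<^sub>m k m) (0\<^sub>m m k) (V * B * dagger V)"
proof -
  have d: "dagger (four_block_mat U (0\<^sub>m k m) (0\<^sub>m m k) V)
      = four_block_mat (dagger U) (0\<^sub>m k m) (0\<^sub>m m k) (dagger V)"
    by (subst dagger_four_block[of _ k k _ m _ m]) (use c in auto)
  have e: "four_block_mat U (0\<^sub>m k m) (0\<^sub>m m k) V * four_block_mat A (0\<^sub>m k m) (0\<^sub>m m k) B
    = four_block_mat (U * A) (0\<^sub>m k m) (0\<^sub>m m k) (V * B)"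
    using c by (subst mult_four_block_mat[of _ k k _ m _ m _ _ k _ m]) auto
  show ?thesis unfolding d e
    using c by (subst mult_four_block_mat[of _ k k _ m _ m _ _ k _ m]) auto
qed

text \<open>Complete \<open>v\<close> to a basis, orthogonalize, and normalize. Gram-Schmidt leaves
  the first vector unchanged, so only the normalization contributes the factor
  \<open>c\<close>.\<close>

lemma unitary_with_first_col:
  fixes v :: "complex vec"
  assumes v: "v \<in> carrier_vec n" "v \<noteq> 0\<^sub>v n"
  obtains W c where "unitary_mat n W" "col W 0 = c \<cdot>\<^sub>v v"
proof -
  interpret cof_vec_space n "TYPE(complex)" .
  define ws where "ws = gram_schmidt n (basis_completion v)"
  note bc = basis_completion[OF v]
  note gs = gram_schmidt_result[OF bc(2) bc(4) bc(5) ws_def]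
  have len: "length ws = n" using gs bc by simp
  have n: "n > 0" using v by (cases n) auto
  have "basis_completion v \<noteq> []" using bc(6) n by auto
  then obtain vs where vs: "basis_completion v = v # vs"
    using bc(7) by (cases "basis_completion v") auto
  have "hd ws = v" unfolding ws_def vs using v by simp
  then have ws0: "ws ! 0 = v" using len n hd_conv_nth[of ws] by force
  have wsc: "ws ! i \<in> carrier_vec n" if "i < n" for i
    using gs(3) len that by auto
  define N where "N i = sqrt (\<Sum>l<n. (cmod (ws ! i $ l))\<^sup>2)" for i
  have ip: "ws ! j \<bullet>c ws ! i = (\<Sum>l<n. ws ! j $ l * cnj (ws ! i $ l))" if "i < n" "j < n" for i j
    using wsc[OF that(1)] wsc[OF that(2)] by (simp add: scalar_prod_def lessThan_atLeast0)
  have N2: "ws ! i \<bullet>c ws ! i = of_real ((N i)\<^sup>2)" if "i < n" for i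
    unfolding ip[OF that that] N_def
    by (simp add: sum_nonneg complex_norm_square[symmetric] flip: of_real_power)
  have orth: "ws ! j \<bullet>c ws ! i = 0 \<longleftrightarrow> j \<noteq> i" if "i < n" "j < n" for i j
    using corthogonalD[OF gs(2)] len that by auto
  have N0: "N i \<noteq> 0" if "i < n" for i
    using orth[OF that that] N2[OF that] by auto
  define W where "W = mat n n (\<lambda>(i, j). ws ! j $ i / of_real (N j))"
  have W: "W \<in> carrier_mat n n" by (simp add: W_def)
  have "dagger W * W = 1\<^sub>m n"
  proof (rule eq_matI)
    fix i j assume "i < dim_row (1\<^sub>m n :: complex mat)" "j < dim_col (1\<^sub>m n :: complex mat)"
    then have ij: "i < n" "j < n" by auto
    have "(dagger W * W) $$ (i, j) = (\<Sum>l<n. cnj (ws ! i $ l) / of_real (N i) * (ws ! j $ l / of_real (N j)))"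
      using ij by (subst index_mult_mat_sum) (auto simp: W_def)
    also have "\<dots> = (ws ! j \<bullet>c ws ! i) / (of_real (N i) * of_real (N j))"
      unfolding ip[OF ij] sum_divide_distrib by (intro sum.cong) (auto simp: field_simps)
    also have "\<dots> = 1\<^sub>m n $$ (i, j)"
      using ij orth[OF ij] N2[OF ij(1)] N0[OF ij(1)] by (auto simp: power2_eq_square)
    finally show "(dagger W * W) $$ (i, j) = 1\<^sub>m n $$ (i, j)" .
  qed (auto simp: W_def)
  then have "unitary_mat n W"
    unfolding unitary_mat_def using W mat_mult_left_right_inverse[OF dagger_carrier[OF W] W] by auto
  moreover have "col W 0 = (1 / of_real (N 0)) \<cdot>\<^sub>v v"
    by (rule eq_vecI) (use n v ws0 in \<open>auto simp: W_def\<close>)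
  ultimately show thesis using that by blast
qed

text \<open>Deflation: split off one eigenvector and apply the induction hypothesis to the remaining
  Hermitian block. The nonincreasing order makes equal eigenvalues contiguous, and the dual case
  relies on this to cut off a leading eigenspace.\<close>

theorem hermitian_diagonalization:
  fixes H :: "complex mat"
  assumes "H \<in> carrier_mat n n" "dagger H = H"
  shows "\<exists>U (d :: nat \<Rightarrow> real). unitary_mat n U \<and> (\<forall>i j. i \<le> j \<and> j < n \<longrightarrow> d j \<le> d i)
    \<and> H = U * mat_diag n (\<lambda>i. of_real (d i)) * dagger U"
  using assms
proof (induction n arbitrary: H)
  case 0
  have "H = 1\<^sub>m 0 * mat_diag 0 (\<lambda>i. of_real 0) * dagger (1\<^sub>m 0)"
    using 0 by (intro eq_matI) auto
  then show ?case using unitary_one[of 0] by (intro exI[of _ "1\<^sub>m 0"] exI[of _ "\<lambda>_. 0"]) auto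
next
  case (Suc n)
  note [simp] = carrier_matD[OF Suc.prems(1)]
  \<comment> \<open>Eigenvalues are not yet known to be real, so one with the largest real part is
    selected; placing it first is what makes the diagonal sorted.\<close>
  let ?S = "Re ` spectrum H"
  have fin: "finite ?S" and ne: "?S \<noteq> {}"
    using card_finite_spectrum[OF Suc.prems(1)] spectrum_non_empty[OF Suc.prems(1)] by auto
  obtain e where e: "e \<in> spectrum H" "Re e = Max ?S"
    using Max_in[OF fin ne] by (metis imageE)
  obtain v where v: "v \<in> carrier_vec (Suc n)" "v \<noteq> 0\<^sub>v (Suc n)" "H *\<^sub>v v = e \<cdot>\<^sub>v v"
    using e(1) by (auto simp: spectrum_def eigenvalue_def eigenvector_def)
  obtain W c where W: "unitary_mat (Suc n) W" and col0: "col W 0 = c \<cdot>\<^sub>v v"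
    using unitary_with_first_col[OF v(1,2)] .
  note [simp] = unitary_matD(1-4)[OF W]
  have Wc: "W \<in> carrier_mat (Suc n) (Suc n)" using W by (simp add: unitary_mat_def)
  define M where "M = dagger W * H * W"
  have Mc: "M \<in> carrier_mat (Suc n) (Suc n)" unfolding M_def by auto
  note [simp] = carrier_matD[OF Mc]
  have Mh: "dagger M = M"
    unfolding M_def using Suc.prems(2) by (simp add: dagger_mult mult_mat_assoc)
  have "col M 0 = dagger W *\<^sub>v (H *\<^sub>v col W 0)"
  proof -
    have "M = dagger W * (H * W)" by (simp add: M_def mult_mat_assoc)
    then show ?thesis
      using col_mult2[of "dagger W" "Suc n" "Suc n" "H * W" "Suc n" 0] col_mult2[OF Suc.prems(1) Wc, of 0]
      by (metis Suc.prems(1) Wc dagger_carrier mult_carrier_mat zero_less_Suc)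
  qed
  also have "H *\<^sub>v col W 0 = e \<cdot>\<^sub>v col W 0"
    unfolding col0 using v Suc.prems(1) mult_mat_vec[OF Suc.prems(1) v(1)]
    by (simp add: smult_smult_assoc mult.commute)
  also have "dagger W *\<^sub>v (e \<cdot>\<^sub>v col W 0) = e \<cdot>\<^sub>v (dagger W *\<^sub>v col W 0)"
    by (rule mult_mat_vec[of _ "Suc n" "Suc n"])
      (use Wc col_carrier_vec[of 0 "Suc n" W "Suc n"] in auto)
  also have "dagger W *\<^sub>v col W 0 = unit_vec (Suc n) 0"
    using col_mult2[OF dagger_carrier[OF Wc] Wc, of 0] by simp
  finally have colM: "col M 0 = e \<cdot>\<^sub>v unit_vec (Suc n) 0" .
  have M0: "M $$ (i, 0) = (if i = 0 then e else 0)" if "i < Suc n" for i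
    using arg_cong[OF colM, of "\<lambda>v. v $ i"] that by (simp add: unit_vec_def)
  have Msym: "M $$ (i, j) = cnj (M $$ (j, i))" if "i < Suc n" "j < Suc n" for i j
    using arg_cong[OF Mh, of "\<lambda>M. M $$ (i, j)"] that by simp
  \<comment> \<open>\<open>M\<close> is Hermitian with corner entry \<open>e\<close>, so
    \<open>e\<close> equals its own conjugate.\<close>
  have er: "e = of_real (Re e)"
    using Msym[of 0 0] M0[of 0] by (simp add: complex_eq_iff)
  have M0': "M $$ (0, j) = (if j = 0 then e else 0)" if "j < Suc n" for j
    using Msym[of 0 j] M0[of j] M0[of 0] that by auto
  define H' where "H' = mat n n (\<lambda>(i, j). M $$ (Suc i, Suc j))"
  have H'c: "H' \<in> carrier_mat n n" by (simp add: H'_def)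
  have "dagger H' = H'"
    by (rule eq_matI) (simp_all add: H'_def Msym[symmetric])
  from Suc.IH[OF H'c this] obtain U' and d' :: "nat \<Rightarrow> real"
    where U': "unitary_mat n U'" and d': "\<And>i j. i \<le> j \<Longrightarrow> j < n \<Longrightarrow> d' j \<le> d' i"
      and H': "H' = U' * mat_diag n (\<lambda>i. of_real (d' i)) * dagger U'" by auto
  define d where "d i = (if i < 1 then Re e else d' (i - 1))" for i
  define F where "F = four_block_mat (1\<^sub>m 1) (0\<^sub>m 1 n) (0\<^sub>m n 1) U'"
  have U'c: "U' \<in> carrier_mat n n" using U' by (simp add: unitary_mat_def)
  have Fu: "unitary_mat (Suc n) F"
    unfolding F_def using unitary_block_diag[OF unitary_one[of 1] U'] by simp
  have Meq: "M = four_block_mat (mat_diag 1 (\<lambda>_. e)) (0\<^sub>m 1 n) (0\<^sub>m n 1) H'"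
    by (rule eq_matI) (use M0 M0' in \<open>auto simp: H'_def\<close>)
  have FDF: "F * mat_diag (Suc n) (\<lambda>i. of_real (d i)) * dagger F = M"
  proof -
    have "mat_diag (Suc n) (\<lambda>i. complex_of_real (d i)) = four_block_mat (mat_diag 1 (\<lambda>_. e)) (0\<^sub>m 1 n)
        (0\<^sub>m n 1) (mat_diag n (\<lambda>i. of_real (d' i)))"
      unfolding four_block_diag_diag using er by (intro eq_matI) (auto simp: d_def)
    then have "F * mat_diag (Suc n) (\<lambda>i. of_real (d i)) * dagger F
        = four_block_mat (1\<^sub>m 1 * mat_diag 1 (\<lambda>_. e) * dagger (1\<^sub>m 1)) (0\<^sub>m 1 n)
        (0\<^sub>m n 1) (U' * mat_diag n (\<lambda>i. of_real (d' i)) * dagger U')"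
      unfolding F_def by (simp only:) (rule block_diag_conj[OF _ U'c], auto)
    then show ?thesis unfolding Meq H'[symmetric] by simp
  qed
  have eq: "H = (W * F) * mat_diag (Suc n) (\<lambda>i. of_real (d i)) * dagger (W * F)"
  proof (rule unitary_conj_decomp[OF W Suc.prems(1)])
    show "F \<in> carrier_mat (Suc n) (Suc n)" using Fu by (simp add: unitary_mat_def)
    show "dagger W * H * W = F * mat_diag (Suc n) (\<lambda>i. of_real (d i)) * dagger F"
      unfolding FDF M_def ..
  qed simp
  have U: "unitary_mat (Suc n) (W * F)" by (rule unitary_mult[OF W Fu])
  \<comment> \<open>By the decomposition just found, each \<open>d i\<close> is an eigenvalue of the
    whole \<open>H\<close>, hence bounded by the maximum chosen at the start.\<close>
  have le: "d i \<le> Re e" if "i < Suc n" for i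
  proof -
    have "of_real (d i) \<in> spectrum H"
      unfolding spectrum_def using diagonalization_eigenvalue[OF U eq that] by simp
    then have "Re (of_real (d i)) \<in> ?S" by blast
    then show ?thesis unfolding e(2) using fin by simp
  qed
  have "d j \<le> d i" if "i \<le> j" "j < Suc n" for i j
    using le[OF that(2)] d'[of "i - 1" "j - 1"] that by (auto simp: d_def split: if_splits)
  then show ?case using U eq by blast
qed

section \<open>Hermitian diagonalization over the dual complex numbers\<close>

lemma std_dual_mat_carrier [intro]:
  "A \<in> carrier_mat n m \<Longrightarrow> std_mat A \<in> carrier_mat n m"
  "A \<in> carrier_mat n m \<Longrightarrow> dual_mat A \<in> carrier_mat n m"
  by auto

definition dual_real :: "real \<Rightarrow> real \<Rightarrow> dual_complex" where
  "dual_real a b = DC (of_real a) (of_real b)"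

lemma dual_real_parts [simp]:
  "std_part (dual_real a b) = of_real a" "dual_part (dual_real a b) = of_real b"
  by (simp_all add: dual_real_def)

text \<open>The disjunction is the total order of dual numbers; with real sequences \<open>a\<close>
  and \<open>b\<close> the diagonal entries are dual numbers by construction.\<close>

definition dual_diagonalizable :: "nat \<Rightarrow> dual_complex mat \<Rightarrow> bool" where
  "dual_diagonalizable n H \<longleftrightarrow> (\<exists>U a b. unitary_mat n U
    \<and> (\<forall>i j. i \<le> j \<and> j < n \<longrightarrow> a j < a i \<or> a j = a i \<and> b j \<le> b i)
    \<and> H = U * mat_diag n (\<lambda>i. dual_real (a i) (b i)) * dagger U)"

lemma dual_diagonalizable_conj:
  assumes W: "unitary_mat n W" and H: "H \<in> carrier_mat n n"
    and dd: "dual_diagonalizable n (dagger W * H * W)"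
  shows "dual_diagonalizable n H"
proof -
  obtain U a b where U: "unitary_mat n U"
    and s: "\<And>i j. i \<le> j \<and> j < n \<longrightarrow> a j < a i \<or> a j = a i \<and> b j \<le> b i"
    and eq: "dagger W * H * W = U * mat_diag n (\<lambda>i. dual_real (a i) (b i)) * dagger U"
    using dd unfolding dual_diagonalizable_def by auto
  have "H = (W * U) * mat_diag n (\<lambda>i. dual_real (a i) (b i)) * dagger (W * U)"
    by (rule unitary_conj_decomp[OF W H _ _ eq]) (use U in \<open>auto simp: unitary_mat_def\<close>)
  then show ?thesis
    unfolding dual_diagonalizable_def using s unitary_mult[OF W U] by blast
qed

text \<open>A scalar standard part commutes with everything, so a complex unitary that diagonalizes
  the dual part, lifted with zero dual part, diagonalizes both.\<close>

lemma dual_diagonalizable_scalar_std: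
  assumes H: "H \<in> carrier_mat n n" "dagger H = H"
    and std: "std_mat H = mat_diag n (\<lambda>_. of_real a)"
  shows "dual_diagonalizable n H"
proof -
  have "dagger (dual_mat H) = dual_mat H"
    using H(2) dual_mat_dagger[of H] by simp
  from hermitian_diagonalization[OF std_dual_mat_carrier(2)[OF H(1)] this] obtain V and b :: "nat \<Rightarrow> real" where V: "unitary_mat n V"
    and b: "\<And>i j. i \<le> j \<and> j < n \<longrightarrow> b j \<le> b i"
    and G: "dual_mat H = V * mat_diag n (\<lambda>i. of_real (b i)) * dagger V"
    by blast
  note [simp] = unitary_matD(1-4)[OF V]
  have "V * mat_diag n (\<lambda>_. complex_of_real a) = mat_diag n (\<lambda>_. of_real a) * V"
    by (rule eq_matI) (simp_all add: mult_diag_index diag_mult_index del: index_mult_mat(1))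
  then have Va: "V * mat_diag n (\<lambda>_. complex_of_real a) * dagger V = mat_diag n (\<lambda>_. of_real a)"
    by (simp add: mult_mat_assoc)
  let ?U = "dmat V (0\<^sub>m n n)"
  have U: "unitary_mat n ?U" by (rule unitary_dmat_zero[OF V])
  have dU: "dual_mat ?U = 0\<^sub>m n n" by simp
  have z: "0\<^sub>m n n * X = 0\<^sub>m n n" "X * 0\<^sub>m n n = 0\<^sub>m n n"
    if "X \<in> carrier_mat n n" for X :: "complex mat"
    using that by auto
  have Vc: "V \<in> carrier_mat n n" using V by (simp add: unitary_mat_def)
  have c: "V * mat_diag n f \<in> carrier_mat n n" "V * mat_diag n f * dagger V \<in> carrier_mat n n" for f
    using Vc by auto
  have "H = ?U * mat_diag n (\<lambda>i. dual_real a (b i)) * dagger ?U"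
  proof (rule dual_mat_eqI)
    show "std_mat H = std_mat (?U * mat_diag n (\<lambda>i. dual_real a (b i)) * dagger ?U)"
      by (simp add: std_mat_mult std_mat_dagger std Va)
    show "dual_mat H = dual_mat (?U * mat_diag n (\<lambda>i. dual_real a (b i)) * dagger ?U)"
      by (simp add: std_mat_mult dual_mat_mult std_mat_dagger dual_mat_dagger dU G z c Vc
          left_add_zero_mat[OF c(2)])
  qed
  then show ?thesis
    unfolding dual_diagonalizable_def using U b
    by (intro exI[of _ ?U] exI[of _ "\<lambda>_. a"] exI[of _ b]) auto
qed

text \<open>On standard parts, both diagonals belong to the spectrum of one complex matrix. This
  carries a gap between two blocks over to whatever eigenvalues are computed for them.\<close>

lemma dual_diagonalization_std:
  assumes U: "unitary_mat n U" and eq: "H = U * mat_diag n (\<lambda>i. dual_real (a i) (b i)) * dagger U"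
    and std: "std_mat H = mat_diag n (\<lambda>i. of_real (c i))" and i: "i < n"
  shows "\<exists>j<n. a i = c j"
proof -
  have d: "dim_row U = n" "dim_col U = n" using unitary_matD[OF U] by auto
  have "std_mat H = std_mat U * mat_diag n (\<lambda>i. of_real (a i)) * dagger (std_mat U)"
    unfolding eq using d by (simp add: std_mat_mult std_mat_dagger)
  from diagonalization_eigenvalue[OF unitary_std_mat[OF U] this i]
  have "complex_of_real (a i) \<in> (\<lambda>i. of_real (c i)) ` {..<n}"
    unfolding std by (rule eigenvalue_mat_diag)
  then show ?thesis by auto
qed

text \<open>\<open>gap\<close> makes the concatenation of the two sorted diagonals sorted; it is
  stated for \<open>c1\<close> and \<open>c2\<close>, which are visible before the blocks are
  diagonalized.\<close>

lemma dual_diagonalizable_block: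
  assumes H1: "dual_diagonalizable k H1" "std_mat H1 = mat_diag k (\<lambda>i. of_real (c1 i))"
    and H2: "dual_diagonalizable m H2" "std_mat H2 = mat_diag m (\<lambda>i. of_real (c2 i))"
    and gap: "\<And>i j. i < k \<Longrightarrow> j < m \<Longrightarrow> c2 j < c1 i"
  shows "dual_diagonalizable (k + m) (four_block_mat H1 (0\<^sub>m k m) (0\<^sub>m m k) H2)"
proof -
  obtain U1 a1 b1 where U1: "unitary_mat k U1"
    and s1: "\<And>i j. i \<le> j \<Longrightarrow> j < k \<Longrightarrow> a1 j < a1 i \<or> a1 j = a1 i \<and> b1 j \<le> b1 i"
    and e1: "H1 = U1 * mat_diag k (\<lambda>i. dual_real (a1 i) (b1 i)) * dagger U1"
    using H1(1) unfolding dual_diagonalizable_def by blast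
  obtain U2 a2 b2 where U2: "unitary_mat m U2"
    and s2: "\<And>i j. i \<le> j \<Longrightarrow> j < m \<Longrightarrow> a2 j < a2 i \<or> a2 j = a2 i \<and> b2 j \<le> b2 i"
    and e2: "H2 = U2 * mat_diag m (\<lambda>i. dual_real (a2 i) (b2 i)) * dagger U2"
    using H2(1) unfolding dual_diagonalizable_def by blast
  define U where "U = four_block_mat U1 (0\<^sub>m k m) (0\<^sub>m m k) U2"
  define a where "a i = (if i < k then a1 i else a2 (i - k))" for i
  define b where "b i = (if i < k then b1 i else b2 (i - k))" for i
  have U: "unitary_mat (k + m) U" unfolding U_def by (rule unitary_block_diag[OF U1 U2])
  have c: "U1 \<in> carrier_mat k k" "U2 \<in> carrier_mat m m"
    using U1 U2 by (auto simp: unitary_mat_def)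
  have "mat_diag (k + m) (\<lambda>i. dual_real (a i) (b i)) = four_block_mat
      (mat_diag k (\<lambda>i. dual_real (a1 i) (b1 i))) (0\<^sub>m k m) (0\<^sub>m m k)
      (mat_diag m (\<lambda>i. dual_real (a2 i) (b2 i)))"
    unfolding four_block_diag_diag by (rule mat_diag_cong) (auto simp: a_def b_def)
  then have eq: "four_block_mat H1 (0\<^sub>m k m) (0\<^sub>m m k) H2
      = U * mat_diag (k + m) (\<lambda>i. dual_real (a i) (b i)) * dagger U"
    unfolding U_def e1 e2 by (simp only: block_diag_conj[OF c mat_diag_dim mat_diag_dim])
  have cross: "a2 j < a1 i" if "i < k" "j < m" for i j
    using dual_diagonalization_std[OF U1 e1 H1(2) that(1)]
      dual_diagonalization_std[OF U2 e2 H2(2) that(2)] gap by auto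
  have "a j < a i \<or> a j = a i \<and> b j \<le> b i" if "i \<le> j" "j < k + m" for i j
    using that s1[of i j] s2[of "i - k" "j - k"] cross[of i "j - k"]
    by (auto simp: a_def b_def)
  then show ?thesis unfolding dual_diagonalizable_def using U eq by blast
qed

text \<open>First-order perturbation theory: conjugation by $1 + \epsilon S$ adds the commutator
  $[D, S]$ to the dual part, which can absorb every entry that couples distinct eigenvalues.\<close>

lemma dual_hermitian_decouple:
  fixes a :: "nat \<Rightarrow> real"
  assumes H: "H \<in> carrier_mat n n" "dagger H = H"
    and std: "std_mat H = mat_diag n (\<lambda>i. of_real (a i))"
  shows "\<exists>T. unitary_mat n T \<and> std_mat (dagger T * H * T) = mat_diag n (\<lambda>i. of_real (a i))
    \<and> (\<forall>i<n. \<forall>j<n. a i \<noteq> a j \<longrightarrow> (dagger T * H * T) $$ (i, j) = 0)"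
proof -
  define G where "G = dual_mat H"
  have Gc: "G \<in> carrier_mat n n" using H(1) by (auto simp: G_def)
  have "dagger G = G" using H(2) dual_mat_dagger[of H] by (simp add: G_def)
  then have Gsym: "cnj (G $$ (j, i)) = G $$ (i, j)" if "i < n" "j < n" for i j
    using that Gc by (metis carrier_matD conjugate_complex_def dagger_index)
  \<comment> \<open>Entrywise solution of (a_i - a_j) S_ij + G_ij = 0 for distinct a_i, a_j, where
    the left side is the new dual part. \<open>S\<close> is skew-Hermitian, since \<open>G\<close>
    is Hermitian and the denominator changes sign under transposition; hence 1 + epsilon S is
    exactly unitary.\<close>
  define S where "S = mat n n (\<lambda>(i, j). if a i = a j then 0 else G $$ (i, j) / of_real (a j - a i))"
  have Sc: "S \<in> carrier_mat n n" by (simp add: S_def)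
  have SS: "dagger S $$ (i, j) = - S $$ (i, j)" if "i < n" "j < n" for i j
    using that Gsym[of j i] Gsym[of i j] by (auto simp: S_def divide_simps algebra_simps)
  define T where "T = dmat (1\<^sub>m n) S"
  note [simp] = carrier_matD[OF Gc] carrier_matD[OF Sc] carrier_matD[OF H(1)]
  have Tp: "std_mat T = 1\<^sub>m n" "dual_mat T = S" "dim_row T = n" "dim_col T = n"
    by (simp_all add: T_def)
  have S0: "S + dagger S = 0\<^sub>m n n" "dagger S + S = 0\<^sub>m n n"
    by (rule eq_matI; simp add: SS del: dagger_index)+
  have "T * dagger T = 1\<^sub>m n"
    by (rule dual_mat_eqI)
      (simp_all add: std_mat_mult dual_mat_mult std_mat_dagger dual_mat_dagger Tp S0)
  moreover have "dagger T * T = 1\<^sub>m n"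
    by (rule dual_mat_eqI)
      (simp_all add: std_mat_mult dual_mat_mult std_mat_dagger dual_mat_dagger Tp S0)
  ultimately have T: "unitary_mat n T"
    using Tp by (auto simp: unitary_mat_def)
  have s: "std_mat (dagger T * H * T) = mat_diag n (\<lambda>i. of_real (a i))"
    by (simp add: std_mat_mult std_mat_dagger Tp std)
  have d: "dual_mat (dagger T * H * T)
      = mat_diag n (\<lambda>i. of_real (a i)) * S + (G + dagger S * mat_diag n (\<lambda>i. of_real (a i)))"
    by (simp add: std_mat_mult dual_mat_mult std_mat_dagger dual_mat_dagger Tp std G_def)
  have "(dagger T * H * T) $$ (i, j) = 0" if "i < n" "j < n" "a i \<noteq> a j" for i j
  proof -
    have "std_part ((dagger T * H * T) $$ (i, j)) = std_mat (dagger T * H * T) $$ (i, j)"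
      using that Tp by simp
    moreover have "dual_part ((dagger T * H * T) $$ (i, j)) = dual_mat (dagger T * H * T) $$ (i, j)"
      using that Tp by simp
    moreover have "dual_mat (dagger T * H * T) $$ (i, j)
        = of_real (a i) * S $$ (i, j) + (G $$ (i, j) - S $$ (i, j) * of_real (a j))"
      unfolding d using that
      by (simp add: diag_mult_index mult_diag_index SS del: index_mult_mat(1) dagger_index)
    moreover have "\<dots> = 0"
      using that by (simp add: S_def field_simps)
    ultimately show ?thesis
      unfolding s using that by (intro dual_complex.expand) auto
  qed
  then show ?thesis using T s by blast
qed

text \<open>Strong induction: once the standard part is diagonal, it is either scalar or its sorted
  diagonal splits into the run of its largest value and the rest. Decoupling makes these two blocks
  independent, and both are smaller than \<open>n\<close>.\<close>

theorem dual_hermitian_diagonalizable: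
  assumes "H \<in> carrier_mat n n" "dagger H = H"
  shows "dual_diagonalizable n H"
  using assms
proof (induction n arbitrary: H rule: less_induct)
  case (less n)
  have hconj: "dagger (dagger T * X * T) = dagger T * X * T" "dagger T * X * T \<in> carrier_mat n n"
    if "unitary_mat n T" "X \<in> carrier_mat n n" "dagger X = X" for T X :: "dual_complex mat"
    using unitary_matD(1,2)[OF that(1)] that(2,3) by (auto simp: dagger_mult mult_mat_assoc)
  have "dagger (std_mat H) = std_mat H" using less.prems(2) std_mat_dagger[of H] by simp
  from hermitian_diagonalization[OF std_dual_mat_carrier(1)[OF less.prems(1)] this] obtain W and a :: "nat \<Rightarrow> real" where W: "unitary_mat n W"
    and sorted: "\<And>i j. i \<le> j \<Longrightarrow> j < n \<Longrightarrow> a j \<le> a i"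
    and eqW: "std_mat H = W * mat_diag n (\<lambda>i. of_real (a i)) * dagger W"
    by blast
  let ?W = "dmat W (0\<^sub>m n n)"
  have W': "unitary_mat n ?W" by (rule unitary_dmat_zero[OF W])
  define H1 where "H1 = dagger ?W * H * ?W"
  note H1 = hconj[OF W' less.prems, folded H1_def]
  have "std_mat H1 = dagger W * (W * mat_diag n (\<lambda>i. of_real (a i)) * dagger W) * W"
    unfolding H1_def eqW[symmetric] using less.prems(1) unitary_matD(1,2)[OF W]
    by (simp add: std_mat_mult std_mat_dagger)
  also have "\<dots> = mat_diag n (\<lambda>i. of_real (a i))"
    using unitary_matD[OF W] by (simp add: mult_mat_assoc)
  finally have std1: "std_mat H1 = mat_diag n (\<lambda>i. of_real (a i))" .
  have "dual_diagonalizable n H1"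
  proof (cases "\<forall>i<n. a i = a 0")
    case True
    then have "std_mat H1 = mat_diag n (\<lambda>_. of_real (a 0))"
      unfolding std1 by (intro mat_diag_cong arg_cong[where f = of_real]) blast
    then show ?thesis by (rule dual_diagonalizable_scalar_std[OF H1(2,1)])
  next
    case False
    \<comment> \<open>The multiplicity of the largest standard eigenvalue; by the order, all entries
      from \<open>k\<close> on are strictly smaller.\<close>
    define k where "k = (LEAST i. i < n \<and> a i \<noteq> a 0)"
    have k: "k < n" "a k \<noteq> a 0"
      using LeastI_ex[of "\<lambda>i. i < n \<and> a i \<noteq> a 0"] False unfolding k_def by auto
    have below: "a i = a 0" if "i < k" for i
      using not_less_Least[of i "\<lambda>i. i < n \<and> a i \<noteq> a 0"] that k(1) unfolding k_def by auto
    have k0: "0 < k" using k(2) by (cases k) auto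
    have above: "a i < a 0" if "k \<le> i" "i < n" for i
      using sorted[OF that] sorted[of 0 k] k by auto
    define m where "m = n - k"
    have n: "n = k + m" "m < n" using k k0 by (auto simp: m_def)
    obtain T where T: "unitary_mat n T"
      and stdT: "std_mat (dagger T * H1 * T) = mat_diag n (\<lambda>i. of_real (a i))"
      and off: "\<And>i j. i < n \<Longrightarrow> j < n \<Longrightarrow> a i \<noteq> a j \<Longrightarrow> (dagger T * H1 * T) $$ (i, j) = 0"
      using dual_hermitian_decouple[OF H1(2,1) std1] by blast
    define H2 where "H2 = dagger T * H1 * T"
    note H2 = hconj[OF T H1(2,1), folded H2_def]
    note [simp] = carrier_matD[OF H2(2)]
    have H2sym: "conjugate (H2 $$ (j, i)) = H2 $$ (i, j)" if "i < n" "j < n" for i j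
      using arg_cong[OF H2(1), of "\<lambda>M. M $$ (i, j)"] that by simp
    have H2std: "std_part (H2 $$ (i, j)) = (if i = j then of_real (a j) else 0)"
      if "i < n" "j < n" for i j
      using arg_cong[OF stdT, of "\<lambda>M. M $$ (i, j)"] that unfolding H2_def[symmetric] by simp
    have gap: "a (j + k) < a i" if "i < k" "j < m" for i j
      using below[OF that(1)] above[of "j + k"] that n by auto
    define B1 where "B1 = mat k k (\<lambda>(i, j). H2 $$ (i, j))"
    define B2 where "B2 = mat m m (\<lambda>(i, j). H2 $$ (i + k, j + k))"
    have "dual_diagonalizable k B1"
      by (rule less.IH[OF k(1)]) (auto simp: B1_def H2sym n intro!: eq_matI)
    moreover have "std_mat B1 = mat_diag k (\<lambda>i. of_real (a i))"
      by (rule eq_matI) (auto simp: B1_def H2std n)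
    moreover have "dual_diagonalizable m B2"
      by (rule less.IH[OF n(2)]) (auto simp: B2_def H2sym n intro!: eq_matI)
    moreover have "std_mat B2 = mat_diag m (\<lambda>i. of_real (a (i + k)))"
      by (rule eq_matI) (auto simp: B2_def H2std n)
    ultimately have "dual_diagonalizable (k + m) (four_block_mat B1 (0\<^sub>m k m) (0\<^sub>m m k) B2)"
      by (rule dual_diagonalizable_block) (rule gap)
    also have "four_block_mat B1 (0\<^sub>m k m) (0\<^sub>m m k) B2 = H2"
    proof (rule eq_matI)
      fix i j assume "i < dim_row H2" "j < dim_col H2"
      then show "four_block_mat B1 (0\<^sub>m k m) (0\<^sub>m m k) B2 $$ (i, j) = H2 $$ (i, j)"
        using off[of i j, folded H2_def] below[of i] below[of j] above[of i] above[of j] n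
        by (auto simp: B1_def B2_def)
    qed (auto simp: B1_def B2_def n)
    finally have "dual_diagonalizable n H2" using n by simp
    then show ?thesis
      using dual_diagonalizable_conj[OF T H1(2)] by (simp add: H2_def)
  qed
  then show ?case using dual_diagonalizable_conj[OF W' less.prems(1)] by (simp add: H1_def)
qed

section \<open>Singular value decomposition\<close>

lemma sum_lessThan_truncate:
  fixes f :: "nat \<Rightarrow> 'a::comm_monoid_add"
  assumes "k \<le> n" "\<And>l. k \<le> l \<Longrightarrow> l < n \<Longrightarrow> f l = 0"
  shows "sum f {..<n} = sum f {..<k}"
  by (rule sum.mono_neutral_right) (use assms in \<open>auto simp: not_less\<close>)

text \<open>If \<open>k < r\<close>, pad \<open>X\<close> and \<open>Y\<close> with zeros to square
  matrices of order \<open>r\<close>. Over a field the one-sided inverse is two-sided, yet row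
  \<open>k\<close> of the padded \<open>Y\<close> is zero.\<close>

lemma mult_eq_one_imp_le:
  fixes X Y :: "'a::field mat"
  assumes X: "X \<in> carrier_mat r k" and Y: "Y \<in> carrier_mat k r" and XY: "X * Y = 1\<^sub>m r"
  shows "r \<le> k"
proof (rule ccontr)
  assume "\<not> r \<le> k"
  then have k: "k < r" by simp
  define X' where "X' = mat r r (\<lambda>(i, j). if j < k then X $$ (i, j) else 0)"
  define Y' where "Y' = mat r r (\<lambda>(i, j). if i < k then Y $$ (i, j) else 0)"
  have "X' * Y' = 1\<^sub>m r"
  proof (rule eq_matI)
    fix i j assume ij: "i < dim_row (1\<^sub>m r :: 'a mat)" "j < dim_col (1\<^sub>m r :: 'a mat)"
    have "(X' * Y') $$ (i, j) = (\<Sum>l<r. X' $$ (i, l) * Y' $$ (l, j))"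
      using ij by (subst index_mult_mat_sum) (auto simp: X'_def Y'_def)
    also have "\<dots> = (\<Sum>l<k. X' $$ (i, l) * Y' $$ (l, j))"
      by (rule sum_lessThan_truncate) (use k ij in \<open>auto simp: X'_def Y'_def\<close>)
    also have "\<dots> = (\<Sum>l<k. X $$ (i, l) * Y $$ (l, j))"
      by (rule sum.cong) (use k ij in \<open>auto simp: X'_def Y'_def\<close>)
    also have "\<dots> = (X * Y) $$ (i, j)"
      using ij X Y by (subst index_mult_mat_sum) auto
    finally show "(X' * Y') $$ (i, j) = 1\<^sub>m r $$ (i, j)" unfolding XY .
  qed (auto simp: X'_def Y'_def)
  then have "Y' * X' = 1\<^sub>m r"
    by (intro mat_mult_left_right_inverse[of X' r Y']) (auto simp: X'_def Y'_def)
  then have "(Y' * X') $$ (k, k) = 1" using k by simp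
  moreover have "(Y' * X') $$ (k, k) = (\<Sum>l<r. Y' $$ (k, l) * X' $$ (l, k))"
    using k by (subst index_mult_mat_sum) (auto simp: X'_def Y'_def)
  moreover have "\<dots> = 0"
    by (rule sum.neutral) (use k in \<open>auto simp: Y'_def\<close>)
  ultimately show False by simp
qed

lemma mult_eq_one_imp_le_dual:
  assumes "X \<in> carrier_mat r k" "Y \<in> carrier_mat k r" "X * Y = (1\<^sub>m r :: dual_complex mat)"
  shows "r \<le> k"
proof (rule mult_eq_one_imp_le)
  show "std_mat X * std_mat Y = 1\<^sub>m r"
    using assms by (metis carrier_matD std_mat_mult std_mat_one)
qed (use assms in auto)

text \<open>Diagonalize the Hermitian idempotent $Q^* Q$: in the new coordinates $Q$ becomes $[C\; 0]$
  with $C$ square unitary, and this is completed by an identity block.\<close>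

lemma orthonormal_rows_extend:
  fixes Q :: "dual_complex mat"
  assumes Q: "Q \<in> carrier_mat r n" "Q * dagger Q = 1\<^sub>m r"
  shows "r \<le> n \<and> (\<exists>V. unitary_mat n V \<and> (\<forall>i<r. \<forall>j<n. V $$ (i, j) = Q $$ (i, j)))"
proof -
  note [simp] = carrier_matD[OF Q(1)]
  have rn: "r \<le> n" using mult_eq_one_imp_le_dual[OF Q(1) dagger_carrier[OF Q(1)] Q(2)] .
  define H where "H = dagger Q * Q"
  have Hc: "H \<in> carrier_mat n n" by (auto simp: H_def)
  have "dagger H = H" by (simp add: H_def dagger_mult)
  from dual_hermitian_diagonalizable[OF Hc this]
  obtain V a b where V: "unitary_mat n V"
    and s: "\<And>i j. i \<le> j \<Longrightarrow> j < n \<Longrightarrow> a j < a i \<or> a j = a i \<and> b j \<le> b i"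
    and HV: "H = V * mat_diag n (\<lambda>i. dual_real (a i) (b i)) * dagger V"
    unfolding dual_diagonalizable_def by blast
  define D where "D = mat_diag n (\<lambda>i. dual_real (a i) (b i))"
  define C where "C = Q * V"
  have Vd: "dim_row V = n" "dim_col V = n" using unitary_matD[OF V] by auto
  have Vc: "V \<in> carrier_mat n n" using V by (simp add: unitary_mat_def)
  have Cc: "C \<in> carrier_mat r n" using Vd by (auto simp: C_def)
  note [simp] = carrier_matD[OF Cc] Vd
  have Dd: "dim_row D = n" "dim_col D = n" by (simp_all add: D_def)
  have CC: "C * dagger C = 1\<^sub>m r"
    using Q(2) by (simp add: C_def dagger_mult mult_mat_assoc unitary_matD(5)[OF V])
  have "dagger V * H * V = D"
    unfolding HV D_def[symmetric] using Dd
    by (simp add: mult_mat_assoc unitary_matD(6)[OF V] unitary_matD(4)[OF V])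
  then have CCD: "dagger C * C = D"
    by (simp add: C_def H_def dagger_mult mult_mat_assoc)
  \<comment> \<open>Orthonormal rows give C C^* C = C. This makes \<open>D\<close> idempotent and
    later kills the columns of \<open>C\<close> at zero entries of \<open>D\<close>.\<close>
  have CD: "C * D = C"
    unfolding CCD[symmetric] by (subst mult_mat_assoc[symmetric]) (simp_all add: CC)
  have "D * D = dagger C * C * D" unfolding CCD ..
  also have "\<dots> = dagger C * (C * D)" by (rule mult_mat_assoc) (simp_all add: Dd)
  also have "\<dots> = D" unfolding CD CCD ..
  finally have DD: "D * D = D" .
  have "dual_real (a i) (b i) * dual_real (a i) (b i) = dual_real (a i) (b i)" if "i < n" for i
    using arg_cong[OF DD, of "\<lambda>M. M $$ (i, i)"] that by (simp add: D_def)
  then have sq: "of_real (a i) * of_real (a i) = complex_of_real (a i)"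
    "of_real (a i) * of_real (b i) + of_real (b i) * of_real (a i) = complex_of_real (b i)"
    if "i < n" for i
    using that by (metis dual_real_parts(1) std_dual_part_simps(11),
        metis dual_real_parts std_dual_part_simps(12))
  \<comment> \<open>The only idempotent dual numbers are 0 and 1: for \<open>a i\<close> equal to 0
    or 1, the equation 2ab = b leaves \<open>b i = 0\<close>.\<close>
  have a01: "a i = 0 \<and> b i = 0 \<or> a i = 1 \<and> b i = 0" if "i < n" for i
  proof -
    have "a i * a i = a i" "a i * b i + b i * a i = b i"
      using sq[OF that] by (metis of_real_eq_iff of_real_mult, metis of_real_add of_real_eq_iff of_real_mult)
    then show ?thesis by auto
  qed
  \<comment> \<open>Sortedness puts the ones first, so \<open>k\<close> counts them. With
    \<open>i < n\<close> inside the negation, \<open>n\<close> qualifies and the least element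
    exists.\<close>
  define k where "k = (LEAST i. \<not> (i < n \<and> a i = 1))"
  have kL: "\<not> (k < n \<and> a k = 1)"
    unfolding k_def by (rule LeastI[of _ n]) simp
  have below: "i < n \<and> a i = 1" if "i < k" for i
    using not_less_Least[of i "\<lambda>i. \<not> (i < n \<and> a i = 1)"] that unfolding k_def by auto
  have kn: "k \<le> n" using below[of n] by (cases "n < k") auto
  have above: "a i = 0" if "k \<le> i" "i < n" for i
    using s[OF that] a01[of k] a01[of i] kL that by auto
  have Dij: "D $$ (i, j) = (if i = j \<and> j < k then 1 else 0)" if "i < n" "j < n" for i j
    using that below[of j] above[of j] a01[OF that(2)]
    by (auto simp: D_def dual_real_def one_dual_complex_def zero_dual_complex_def)
  have C0: "C $$ (i, j) = 0" if "i < r" "k \<le> j" "j < n" for i j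
  proof -
    have "C $$ (i, j) = (C * D) $$ (i, j)" by (simp add: CD)
    also have "\<dots> = C $$ (i, j) * dual_real (a j) (b j)"
      unfolding D_def using that by (simp add: mult_diag_index del: index_mult_mat(1))
    also have "dual_real (a j) (b j) = 0"
      using above[OF that(2,3)] a01[OF that(3)] by (auto simp: dual_real_def zero_dual_complex_def)
    finally show ?thesis by simp
  qed
  define C1 where "C1 = mat r k (\<lambda>(i, j). C $$ (i, j))"
  have C1c: "C1 \<in> carrier_mat r k" by (simp add: C1_def)
  have C1a: "C1 * dagger C1 = 1\<^sub>m r"
  proof (rule eq_matI)
    fix i j assume ij: "i < dim_row (1\<^sub>m r :: dual_complex mat)" "j < dim_col (1\<^sub>m r :: dual_complex mat)"
    have "(C1 * dagger C1) $$ (i, j) = (\<Sum>l<k. C $$ (i, l) * conjugate (C $$ (j, l)))"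
      using ij by (subst index_mult_dagger[OF C1c]) (auto simp: C1_def)
    also have "\<dots> = (\<Sum>l<n. C $$ (i, l) * conjugate (C $$ (j, l)))"
      by (rule sum_lessThan_truncate[symmetric]) (use C0 kn ij in auto)
    also have "\<dots> = (C * dagger C) $$ (i, j)"
      using ij by (subst index_mult_dagger[OF Cc]) auto
    finally show "(C1 * dagger C1) $$ (i, j) = 1\<^sub>m r $$ (i, j)" unfolding CC .
  qed (auto simp: C1_def)
  have C1b: "dagger C1 * C1 = 1\<^sub>m k"
  proof (rule eq_matI)
    fix i j assume ij: "i < dim_row (1\<^sub>m k :: dual_complex mat)" "j < dim_col (1\<^sub>m k :: dual_complex mat)"
    have "(dagger C1 * C1) $$ (i, j) = (\<Sum>l<r. conjugate (C $$ (l, i)) * C $$ (l, j))"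
      using ij by (subst index_mult_mat_sum) (auto simp: C1_def)
    also have "\<dots> = (dagger C * C) $$ (i, j)"
      using ij kn by (subst index_mult_mat_sum) auto
    finally show "(dagger C1 * C1) $$ (i, j) = 1\<^sub>m k $$ (i, j)"
      unfolding CCD using ij kn Dij by auto
  qed (auto simp: C1_def)
  \<comment> \<open>The dimension count applied to both identities makes \<open>C1\<close>
    square.\<close>
  have "r = k"
    using mult_eq_one_imp_le_dual[OF C1c dagger_carrier[OF C1c] C1a]
      mult_eq_one_imp_le_dual[OF dagger_carrier[OF C1c] C1c C1b] by simp
  then have "unitary_mat r C1"
    using C1c C1a C1b by (simp add: unitary_mat_def)
  from unitary_block_diag[OF this unitary_one[of "n - r"]]
  have Fu: "unitary_mat n (four_block_mat C1 (0\<^sub>m r (n - r)) (0\<^sub>m (n - r) r) (1\<^sub>m (n - r)))"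
    using rn by simp
  define F where "F = four_block_mat C1 (0\<^sub>m r (n - r)) (0\<^sub>m (n - r) r) (1\<^sub>m (n - r))"
  have Fd: "dim_row F = n" "dim_col F = n" using unitary_matD[OF Fu] by (simp_all add: F_def)
  have Fi: "F $$ (i, l) = C $$ (i, l)" if "i < r" "l < n" for i l
    unfolding F_def using that C0[of i l] \<open>r = k\<close> by (auto simp: C1_def)
  have "(F * dagger V) $$ (i, j) = Q $$ (i, j)" if "i < r" "j < n" for i j
  proof -
    have "(F * dagger V) $$ (i, j) = (\<Sum>l<n. F $$ (i, l) * dagger V $$ (l, j))"
      using that rn Fd by (subst index_mult_mat_sum) auto
    also have "\<dots> = (\<Sum>l<n. C $$ (i, l) * dagger V $$ (l, j))"
      by (rule sum.cong) (use Fi that in auto)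
    also have "\<dots> = (C * dagger V) $$ (i, j)"
      using that by (subst index_mult_mat_sum) auto
    also have "C * dagger V = Q"
      by (simp add: C_def mult_mat_assoc unitary_matD(3)[OF V])
    finally show ?thesis .
  qed
  moreover have "unitary_mat n (F * dagger V)"
    unfolding F_def by (rule unitary_mult[OF Fu unitary_dagger[OF V]])
  ultimately show ?thesis using rn by blast
qed

section \<open>Existence of the decomposition\<close>

lemma four_block_mat_diag_zero:
  assumes "t \<le> n"
  shows "four_block_mat (mat_diag t \<mu>) (0\<^sub>m t (n - t)) (0\<^sub>m (n - t) t) (0\<^sub>m (n - t) (n - t))
    = mat_diag n (\<lambda>i. if i < t then \<mu> i else 0)"
  by (rule eq_matI) (use assms in auto)

text \<open>Write $P^* A = B$ with $B B^*$ diagonal. A row of $B$ belonging to an infinitesimal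
  eigenvalue has zero standard part, and its dual part $x$ satisfies $x B_s^* = 0$. The relation
  $A = A^2 Y$ puts $x$ into the row space of $B_s$, so $x = 0$.\<close>

lemma small_rows_vanish:
  fixes B P Y :: "dual_complex mat" and a b :: "nat \<Rightarrow> real"
  assumes c: "B \<in> carrier_mat n n" "P \<in> carrier_mat n n" "Y \<in> carrier_mat n n"
    and BB: "B * dagger B = mat_diag n (\<lambda>i. dual_real (a i) (b i))"
    and B: "B = B * (P * B * Y)"
    and r: "r \<le> n" "\<And>i. i < r \<Longrightarrow> a i > 0" "\<And>i. r \<le> i \<Longrightarrow> i < n \<Longrightarrow> a i \<le> 0"
    and ij: "r \<le> i" "i < n" "j < n"
  shows "B $$ (i, j) = 0"
proof -
  define Bs Bd Ps Ys where "Bs = std_mat B" and "Bd = dual_mat B" and "Ps = std_mat P" and "Ys = std_mat Y"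
  have cs: "Bs \<in> carrier_mat n n" "Bd \<in> carrier_mat n n" "Ps \<in> carrier_mat n n" "Ys \<in> carrier_mat n n"
    unfolding Bs_def Bd_def Ps_def Ys_def using c by auto
  note [simp] = carrier_matD[OF c(1)] carrier_matD[OF c(2)] carrier_matD[OF c(3)]
    carrier_matD[OF cs(1)] carrier_matD[OF cs(2)] carrier_matD[OF cs(3)] carrier_matD[OF cs(4)]
  have BBs: "Bs * dagger Bs = mat_diag n (\<lambda>i. of_real (a i))"
    using arg_cong[OF BB, of std_mat] by (simp add: std_mat_mult std_mat_dagger Bs_def)
  have BBd: "Bs * dagger Bd + Bd * dagger Bs = mat_diag n (\<lambda>i. of_real (b i))"
    using arg_cong[OF BB, of dual_mat]
    by (simp add: dual_mat_mult dual_mat_dagger std_mat_dagger Bs_def Bd_def)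
  \<comment> \<open>Diagonal entry \<open>i\<close> of \<open>Bs * dagger Bs\<close> is a sum of
    squared moduli, so \<open>a i \<le> 0\<close> annihilates the row.\<close>
  have Bs_zero: "Bs $$ (i, l) = 0" if "r \<le> i" "i < n" "l < n" for i l
  proof -
    have "(\<Sum>l<n. of_real ((cmod (Bs $$ (i, l)))\<^sup>2)) = complex_of_real (a i)"
      using arg_cong[OF BBs, of "\<lambda>M. M $$ (i, i)"] that index_mult_dagger[OF cs(1), of i i]
      by (simp add: complex_norm_square del: index_mult_mat(1) of_real_power)
    then have e: "(\<Sum>l<n. (cmod (Bs $$ (i, l)))\<^sup>2) = a i"
      by (metis of_real_eq_iff of_real_sum)
    then have "(\<Sum>l<n. (cmod (Bs $$ (i, l)))\<^sup>2) = 0"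
      using r(3)[OF that(1,2)] sum_nonneg[of "{..<n}" "\<lambda>l. (cmod (Bs $$ (i, l)))\<^sup>2"] by auto
    then have "(cmod (Bs $$ (i, l)))\<^sup>2 = 0"
      using that by (subst (asm) sum_nonneg_eq_0_iff) auto
    then show ?thesis by simp
  qed
  \<comment> \<open>Only the first \<open>r\<close> rows of \<open>Bs\<close> survive.
    \<open>Bt\<close> collects them and \<open>P1\<close> the columns of \<open>Ps\<close> that meet
    them, so the standard part of \<open>P * B * Y\<close> factors as \<open>P1 * W\<close> through
    dimension \<open>r\<close>. \<open>X\<close> holds the dual parts of the remaining rows, padded
    with zero rows.\<close>
  define Bt where "Bt = mat r n (\<lambda>(i, j). Bs $$ (i, j))"
  define P1 where "P1 = mat n r (\<lambda>(i, j). Ps $$ (i, j))"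
  define W where "W = Bt * Ys"
  define \<Lambda> where "\<Lambda> = mat_diag r (\<lambda>i. complex_of_real (a i))"
  define \<Lambda>i where "\<Lambda>i = mat_diag r (\<lambda>i. complex_of_real (1 / a i))"
  define X where "X = mat n n (\<lambda>(i, j). if i < r then 0 else Bd $$ (i, j))"
  have [simp]: "dim_row Bt = r" "dim_col Bt = n" "dim_row P1 = n" "dim_col P1 = r"
    "dim_row W = r" "dim_col W = n" "dim_row \<Lambda> = r" "dim_col \<Lambda> = r"
    "dim_row \<Lambda>i = r" "dim_col \<Lambda>i = r" "dim_row X = n" "dim_col X = n"
    by (simp_all add: Bt_def P1_def W_def \<Lambda>_def \<Lambda>i_def X_def)
  have \<Lambda>\<Lambda>i: "\<Lambda> * \<Lambda>i = 1\<^sub>m r"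
  proof -
    have "\<Lambda> * \<Lambda>i = mat_diag r (\<lambda>_. 1)"
      unfolding \<Lambda>_def \<Lambda>i_def mat_diag_diag
      by (rule mat_diag_cong) (use r(2) in \<open>force simp flip: of_real_mult\<close>)
    then show ?thesis by simp
  qed
  have BtBt: "Bt * dagger Bt = \<Lambda>"
  proof (rule eq_matI)
    fix i j assume ij: "i < dim_row \<Lambda>" "j < dim_col \<Lambda>"
    have "(Bt * dagger Bt) $$ (i, j) = (\<Sum>l<n. Bs $$ (i, l) * conjugate (Bs $$ (j, l)))"
      using ij by (subst index_mult_dagger[of _ r n]) (auto simp: Bt_def)
    also have "\<dots> = (Bs * dagger Bs) $$ (i, j)"
      using ij r(1) by (subst index_mult_dagger[OF cs(1)]) auto
    finally show "(Bt * dagger Bt) $$ (i, j) = \<Lambda> $$ (i, j)"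
      unfolding BBs using ij r(1) by (auto simp: \<Lambda>_def)
  qed auto
  have PB: "Ps * Bs = P1 * Bt"
  proof (rule eq_matI)
    fix i j assume ij: "i < dim_row (P1 * Bt)" "j < dim_col (P1 * Bt)"
    have "(Ps * Bs) $$ (i, j) = (\<Sum>l<n. Ps $$ (i, l) * Bs $$ (l, j))"
      using ij by (subst index_mult_mat_sum) auto
    also have "\<dots> = (\<Sum>l<r. Ps $$ (i, l) * Bs $$ (l, j))"
      by (rule sum_lessThan_truncate) (use ij r(1) Bs_zero in auto)
    also have "\<dots> = (P1 * Bt) $$ (i, j)"
      using ij by (subst index_mult_mat_sum) (auto simp: P1_def Bt_def)
    finally show "(Ps * Bs) $$ (i, j) = (P1 * Bt) $$ (i, j)" .
  qed auto
  have "std_mat (P * B * Y) = Ps * Bs * Ys"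
    by (simp add: std_mat_mult flip: Ps_def Bs_def Ys_def)
  then have E: "std_mat (P * B * Y) = P1 * W"
    unfolding PB W_def by (simp add: mult_mat_assoc)
  have Bs_fix: "Bs = Bs * (P1 * W)"
    using arg_cong[OF B, of std_mat] by (simp add: std_mat_mult E flip: Bs_def)
  have Bt_fix: "Bt = Bt * (P1 * W)"
  proof (rule eq_matI)
    fix i j assume "i < dim_row (Bt * (P1 * W))" "j < dim_col (Bt * (P1 * W))"
    then have ij: "i < r" "j < n" by auto
    have "(Bt * (P1 * W)) $$ (i, j) = (\<Sum>l<n. Bs $$ (i, l) * (P1 * W) $$ (l, j))"
      using ij by (subst index_mult_mat_sum) (auto simp: Bt_def)
    also have "\<dots> = (Bs * (P1 * W)) $$ (i, j)"
      using ij r(1) by (subst index_mult_mat_sum) auto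
    finally show "Bt $$ (i, j) = (Bt * (P1 * W)) $$ (i, j)"
      using ij Bs_fix by (simp add: Bt_def)
  qed auto
  \<comment> \<open>Multiplying \<open>Bt = Bt * (P1 * W)\<close> by
    \<open>dagger Bt * \<Lambda>i\<close> exhibits a right inverse of the square complex matrix
    \<open>Bt * P1\<close>. It is then a left inverse too, which expresses \<open>W\<close> through
    \<open>Bt\<close>.\<close>
  have "(Bt * P1) * (W * dagger Bt * \<Lambda>i) = 1\<^sub>m r"
  proof -
    have "(Bt * P1) * (W * dagger Bt * \<Lambda>i) = (Bt * (P1 * W)) * dagger Bt * \<Lambda>i"
      by (simp add: mult_mat_assoc)
    then show ?thesis by (simp add: BtBt \<Lambda>\<Lambda>i flip: Bt_fix)
  qed
  then have inv: "(W * dagger Bt * \<Lambda>i) * (Bt * P1) = 1\<^sub>m r"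
    by (intro mat_mult_left_right_inverse[of "Bt * P1" r]) auto
  have W: "W = W * dagger Bt * \<Lambda>i * Bt"
  proof -
    have "W = ((W * dagger Bt * \<Lambda>i) * (Bt * P1)) * W" unfolding inv by simp
    also have "\<dots> = (W * dagger Bt * \<Lambda>i) * (Bt * (P1 * W))" by (simp add: mult_mat_assoc)
    finally show ?thesis by (simp flip: Bt_fix)
  qed
  \<comment> \<open>In the rows from \<open>r\<close> on, the summand with \<open>Bs\<close> drops
    out. Hence \<open>X\<close> is fixed by \<open>P1 * W\<close>, and its rows lie in the row space
    of \<open>W\<close>, thus of \<open>Bt\<close>.\<close>
  have Bd_fix: "Bd = Bs * dual_mat (P * B * Y) + Bd * (P1 * W)"
    using arg_cong[OF B, of dual_mat] by (simp add: dual_mat_mult[of B] E flip: Bs_def Bd_def)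
  have X_fix: "X = X * (P1 * W)"
  proof (rule eq_matI)
    fix i j assume "i < dim_row (X * (P1 * W))" "j < dim_col (X * (P1 * W))"
    then have ij: "i < n" "j < n" by auto
    have e: "(X * (P1 * W)) $$ (i, j) = (\<Sum>l<n. X $$ (i, l) * (P1 * W) $$ (l, j))"
      using ij by (subst index_mult_mat_sum) auto
    show "X $$ (i, j) = (X * (P1 * W)) $$ (i, j)"
    proof (cases "i < r")
      case True
      then show ?thesis unfolding e using ij by (simp add: X_def)
    next
      case False
      have z: "(Bs * dual_mat (P * B * Y)) $$ (i, j) = 0"
        using ij False Bs_zero by (subst index_mult_mat_sum) (auto intro!: sum.neutral)
      have "X $$ (i, j) = Bd $$ (i, j)" using False ij by (simp add: X_def)
      also have "\<dots> = (Bs * dual_mat (P * B * Y) + Bd * (P1 * W)) $$ (i, j)"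
        using Bd_fix by simp
      also have "\<dots> = (Bd * (P1 * W)) $$ (i, j)"
        using ij z by (simp del: index_mult_mat(1))
      also have "\<dots> = (\<Sum>l<n. X $$ (i, l) * (P1 * W) $$ (l, j))"
        using ij False by (subst index_mult_mat_sum) (auto simp: X_def intro!: sum.cong)
      finally show ?thesis unfolding e .
    qed
  qed auto
  \<comment> \<open>This is the lower left block of the dual part of \<open>B * dagger B\<close>,
    which is diagonal; the other summand there contains vanishing rows of \<open>Bs\<close>.\<close>
  have XBt: "X * dagger Bt = 0\<^sub>m n r"
  proof (rule eq_matI)
    fix i j assume "i < dim_row (0\<^sub>m n r :: complex mat)" "j < dim_col (0\<^sub>m n r :: complex mat)"
    then have ij: "i < n" "j < r" "j < n" using r(1) by auto
    have e: "(X * dagger Bt) $$ (i, j) = (\<Sum>l<n. X $$ (i, l) * conjugate (Bt $$ (j, l)))"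
      using ij by (subst index_mult_mat_sum) auto
    show "(X * dagger Bt) $$ (i, j) = 0\<^sub>m n r $$ (i, j)"
    proof (cases "i < r")
      case True
      then show ?thesis unfolding e using ij by (simp add: X_def)
    next
      case False
      have z: "(Bs * dagger Bd) $$ (i, j) = 0"
        using ij False Bs_zero by (subst index_mult_mat_sum) (auto intro!: sum.neutral)
      have "(Bs * dagger Bd + Bd * dagger Bs) $$ (i, j) = 0"
        unfolding BBd using ij False by simp
      then have "(Bd * dagger Bs) $$ (i, j) = 0"
        using ij z by (simp del: index_mult_mat(1))
      also have "(Bd * dagger Bs) $$ (i, j) = (X * dagger Bt) $$ (i, j)"
        unfolding e using ij False
        by (subst index_mult_mat_sum) (auto simp: X_def Bt_def intro!: sum.cong)
      finally show ?thesis using ij by simp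
    qed
  qed auto
  define Z where "Z = X * P1 * (W * dagger Bt * \<Lambda>i)"
  have [simp]: "dim_row Z = n" "dim_col Z = r" by (simp_all add: Z_def)
  have XZ: "X = Z * Bt"
  proof -
    have "X = X * P1 * W" using X_fix by (simp add: mult_mat_assoc)
    also have "\<dots> = X * P1 * (W * dagger Bt * \<Lambda>i * Bt)" by (simp flip: W)
    also have "\<dots> = Z * Bt" by (simp add: Z_def mult_mat_assoc)
    finally show ?thesis .
  qed
  \<comment> \<open>A row space meets its orthogonal complement only in 0; here because the Gram
    matrix \<open>\<Lambda>\<close> of \<open>Bt\<close> is invertible.\<close>
  have "Z * \<Lambda> = 0\<^sub>m n r"
    using XBt unfolding XZ by (simp add: mult_mat_assoc BtBt)
  then have "Z * \<Lambda> * \<Lambda>i = 0\<^sub>m n r" by auto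
  then have "Z = 0\<^sub>m n r" by (simp add: mult_mat_assoc \<Lambda>\<Lambda>i)
  then have "X = 0\<^sub>m n n" unfolding XZ by auto
  then have "X $$ (i, j) = 0" using ij by (simp only: index_zero_mat)
  then have "Bd $$ (i, j) = 0" using ij by (simp add: X_def)
  then show ?thesis
    using Bs_zero[OF ij] ij by (intro dual_complex.expand) (simp add: Bs_def Bd_def)
qed

text \<open>The factorization through \<open>Y\<close> removes the rows that A A^* leaves
  undetermined. The right factor arises by normalizing the other rows of P^* A and completing them
  to a unitary matrix.\<close>

lemma dual_SVD_exists:
  assumes A: "A \<in> carrier_mat n n" and Y: "Y \<in> carrier_mat n n" "A = A * A * Y"
  shows "\<exists>t \<mu> P V. dual_SVD A t \<mu> P V"
proof -
  note [simp] = carrier_matD[OF A] carrier_matD[OF Y(1)]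
  have AA: "A * dagger A \<in> carrier_mat n n" "dagger (A * dagger A) = A * dagger A"
    by (auto simp: dagger_mult)
  obtain P a b where P: "unitary_mat n P"
    and s: "\<And>i j. i \<le> j \<Longrightarrow> j < n \<Longrightarrow> a j < a i \<or> a j = a i \<and> b j \<le> b i"
    and AAP: "A * dagger A = P * mat_diag n (\<lambda>i. dual_real (a i) (b i)) * dagger P"
    using dual_hermitian_diagonalizable[OF AA] unfolding dual_diagonalizable_def by blast
  note [simp] = unitary_matD(1,2)[OF P]
  have Pc: "P \<in> carrier_mat n n" using P by (simp add: unitary_mat_def)
  define B where "B = dagger P * A"
  have Bc: "B \<in> carrier_mat n n" by (auto simp: B_def)
  note [simp] = carrier_matD[OF Bc]
  have AB: "A = P * B" by (simp add: B_def unitary_matD(5)[OF P])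
  have BB: "B * dagger B = mat_diag n (\<lambda>i. dual_real (a i) (b i))"
  proof -
    have "B * dagger B = dagger P * (A * dagger A) * P"
      by (simp add: B_def dagger_mult mult_mat_assoc)
    also have "\<dots> = mat_diag n (\<lambda>i. dual_real (a i) (b i))"
      unfolding AAP by (simp add: mult_mat_assoc unitary_matD(6)[OF P] unitary_matD(4)[OF P])
    finally show ?thesis .
  qed
  have B: "B = B * (P * B * Y)"
  proof -
    have "B = dagger P * (A * A * Y)" using Y(2) by (simp add: B_def)
    also have "\<dots> = B * (P * B * Y)" by (simp add: AB mult_mat_assoc unitary_matD(6)[OF P])
    finally show ?thesis .
  qed
  define r where "r = (LEAST i. \<not> (i < n \<and> a i > 0))"
  have rL: "\<not> (r < n \<and> a r > 0)"
    unfolding r_def by (rule LeastI[of _ n]) simp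
  have below: "i < n \<and> a i > 0" if "i < r" for i
    using not_less_Least[of i "\<lambda>i. \<not> (i < n \<and> a i > 0)"] that unfolding r_def by auto
  have rn: "r \<le> n" using below[of n] by (cases "n < r") auto
  have above: "a i \<le> 0" if "r \<le> i" "i < n" for i
    using s[OF that] rL that by auto
  have B0: "B $$ (i, j) = 0" if "r \<le> i" "i < n" "j < n" for i j
    by (rule small_rows_vanish[OF Bc Pc Y(1) BB B rn]) (use below above that in auto)
  \<comment> \<open>The dual square root of the eigenvalue, from (x + epsilon y)^2 = x^2 + 2 epsilon
    x y, and below it its inverse \<open>\<nu>\<close>. Both are meaningful where
    \<open>a i > 0\<close>, that is below \<open>r\<close>.\<close>
  define \<mu> where "\<mu> i = dual_real (sqrt (a i)) (b i / (2 * sqrt (a i)))" for i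
  define \<nu> where "\<nu> i = dual_real (1 / sqrt (a i)) (- b i / (2 * a i * sqrt (a i)))" for i
  have munu: "\<mu> i * \<nu> i = 1" if "i < r" for i
  proof (rule dual_complex.expand)
    have *: "sqrt (a i) > 0" using below[OF that] by simp
    have "sqrt (a i) * (- b i / (2 * a i * sqrt (a i))) + b i / (2 * sqrt (a i)) * (1 / sqrt (a i)) = 0"
      using below[OF that] * by (simp add: field_simps)
    from arg_cong[OF this, of complex_of_real]
    show "std_part (\<mu> i * \<nu> i) = std_part 1 \<and> dual_part (\<mu> i * \<nu> i) = dual_part 1"
      using * by (simp add: \<mu>_def \<nu>_def)
  qed
  have mumu: "\<mu> i * \<mu> i = dual_real (a i) (b i)" if "i < r" for i
  proof (rule dual_complex.expand)
    have *: "sqrt (a i) > 0" using below[OF that] by simp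
    have e: "sqrt (a i) * sqrt (a i) = a i"
      "sqrt (a i) * (b i / (2 * sqrt (a i))) + b i / (2 * sqrt (a i)) * sqrt (a i) = b i"
      using below[OF that] * by (simp_all add: field_simps)
    show "std_part (\<mu> i * \<mu> i) = std_part (dual_real (a i) (b i))
      \<and> dual_part (\<mu> i * \<mu> i) = dual_part (dual_real (a i) (b i))"
      unfolding \<mu>_def std_dual_part_simps dual_real_parts of_real_mult[symmetric]
        of_real_add[symmetric] e by simp
  qed
  have nc: "conjugate (\<nu> i) = \<nu> i" for i
    by (rule dual_complex.expand) (simp add: \<nu>_def)
  define Q where "Q = mat r n (\<lambda>(i, j). \<nu> i * B $$ (i, j))"
  have Qc: "Q \<in> carrier_mat r n" by (simp add: Q_def)
  have "Q * dagger Q = 1\<^sub>m r"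
  proof (rule eq_matI)
    fix i j assume "i < dim_row (1\<^sub>m r :: dual_complex mat)" "j < dim_col (1\<^sub>m r :: dual_complex mat)"
    then have ij: "i < r" "j < r" "i < n" "j < n" using rn by auto
    have "(Q * dagger Q) $$ (i, j) = (\<Sum>l<n. \<nu> i * B $$ (i, l) * (\<nu> j * conjugate (B $$ (j, l))))"
      using ij by (subst index_mult_dagger[OF Qc]) (auto simp: Q_def conjugate_dist_mul nc)
    also have "\<dots> = \<nu> i * \<nu> j * (\<Sum>l<n. B $$ (i, l) * conjugate (B $$ (j, l)))"
      by (simp add: sum_distrib_left mult_ac)
    also have "(\<Sum>l<n. B $$ (i, l) * conjugate (B $$ (j, l))) = (B * dagger B) $$ (i, j)"
      using ij by (simp add: index_mult_dagger[OF Bc] del: index_mult_mat(1))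
    also have "\<nu> i * \<nu> j * (B * dagger B) $$ (i, j) = 1\<^sub>m r $$ (i, j)"
    proof (cases "i = j")
      case True
      have "\<nu> i * \<nu> i * (\<mu> i * \<mu> i) = (\<mu> i * \<nu> i) * (\<mu> i * \<nu> i)" by (simp add: mult_ac)
      then show ?thesis unfolding BB using True ij by (simp add: mumu munu)
    qed (use ij in \<open>simp add: BB\<close>)
    finally show "(Q * dagger Q) $$ (i, j) = 1\<^sub>m r $$ (i, j)" .
  qed (auto simp: Q_def)
  then obtain V where V: "unitary_mat n V" and VQ: "\<And>i j. i < r \<Longrightarrow> j < n \<Longrightarrow> V $$ (i, j) = Q $$ (i, j)"
    using orthonormal_rows_extend[OF Qc] by blast
  note [simp] = unitary_matD(1,2)[OF V]
  have BV: "B = mat_diag n (\<lambda>i. if i < r then \<mu> i else 0) * V"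
  proof (rule eq_matI)
    fix i j assume "i < dim_row (mat_diag n (\<lambda>i. if i < r then \<mu> i else 0) * V)"
      "j < dim_col (mat_diag n (\<lambda>i. if i < r then \<mu> i else 0) * V)"
    then have ij: "i < n" "j < n" by auto
    have "\<mu> i * (\<nu> i * B $$ (i, j)) = B $$ (i, j)" if "i < r"
      using munu[OF that] by (simp flip: mult.assoc)
    then show "B $$ (i, j) = (mat_diag n (\<lambda>i. if i < r then \<mu> i else 0) * V) $$ (i, j)"
      using ij B0[of i j] VQ[of i j]
      by (auto simp: diag_mult_index Q_def simp del: index_mult_mat(1))
  qed auto
  have "dual_positive (\<mu> i)" if "i < r" for i
    using below[OF that]
    by (auto simp: dual_positive_def dual_number_def dual_le_def \<mu>_def
        simp flip: dual_complex.expand) (metis dual_real_parts(1) of_real_eq_0_iff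
        real_sqrt_eq_zero_cancel_iff std_dual_part_simps(1) less_irrefl)
  moreover have "nonincreasing_duals r \<mu>"
    unfolding nonincreasing_duals_def
  proof (intro allI impI)
    fix i j assume ij: "i \<le> j \<and> j < r"
    then have "a i > 0" "a j > 0" "j < n" using below[of i] below[of j] by auto
    then show "dual_le (\<mu> j) (\<mu> i)"
      using s[of i j] ij by (auto simp: dual_le_def \<mu>_def divide_right_mono)
  qed
  ultimately have "dual_SVD A r \<mu> P (dagger V)"
    unfolding dual_SVD_def Let_def conj_transpose_dagger DC_unitary_iff
    using rn P unitary_dagger[OF V] AB BV
    by (simp add: four_block_mat_diag_zero mult_mat_assoc)
  then show ?thesis by blast
qed

section \<open>The core inverse\<close>

lemma dual_positive_cancel:
  assumes "dual_positive m" "m * x = m * y"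
  shows "std_part x = std_part y"
proof -
  have m: "m \<noteq> 0" using assms(1) by (simp add: dual_positive_def)
  have s: "std_part m * std_part x = std_part m * std_part y"
    and d: "std_part m * dual_part x + dual_part m * std_part x
      = std_part m * dual_part y + dual_part m * std_part y"
    using arg_cong[OF assms(2), of std_part] arg_cong[OF assms(2), of dual_part] by simp_all
  show ?thesis
  proof (cases "std_part m = 0")
    \<comment> \<open>An infinitesimal positive \<open>m\<close> is a zero divisor, but its nonzero
      dual part multiplies the standard parts of \<open>x\<close> and \<open>y\<close> in the dual
      equation. Standard parts are all that can be recovered.\<close>
    case True
    then have "dual_part m \<noteq> 0" using m by (metis dual_complex.expand std_dual_part_simps(1,2))
    then show ?thesis using d True by simp
  qed (use s in simp)
qed

text \<open>As \<open>s\<close> vanishes from \<open>t\<close> on, the leading block factors through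
  the diagonal of order \<open>t\<close>. After dividing by \<open>c\<close> the right factor is
  invertible, so its row \<open>i\<close>, a multiple of \<open>s i\<close>, is not zero. General
  \<open>c\<close> covers appreciability, with all entries 1, and rank comparison, with standard
  parts of singular values.\<close>

lemma diag_factor_nonzero:
  fixes M Z :: "complex mat"
  assumes c: "M \<in> carrier_mat n n" "Z \<in> carrier_mat n n" and t: "t \<le> n"
    and s: "\<And>l. t \<le> l \<Longrightarrow> l < n \<Longrightarrow> s l = 0"
    and e: "\<And>i j. i < t \<Longrightarrow> j < t \<Longrightarrow> (M * mat_diag n s * Z) $$ (i, j) = (if i = j then c i else 0)"
    and c0: "\<And>i. i < t \<Longrightarrow> c i \<noteq> 0"
    and i: "i < t"
  shows "s i \<noteq> 0"
proof -
  note [simp] = carrier_matD[OF c(1)] carrier_matD[OF c(2)]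
  define M1 where "M1 = mat t t (\<lambda>(i, j). M $$ (i, j))"
  define Z1 where "Z1 = mat t t (\<lambda>(i, j). s i * Z $$ (i, j) * (1 / c j))"
  have "M1 * Z1 = 1\<^sub>m t"
  proof (rule eq_matI)
    fix i j assume "i < dim_row (1\<^sub>m t :: complex mat)" "j < dim_col (1\<^sub>m t :: complex mat)"
    then have ij: "i < t" "j < t" "i < n" "j < n" using t by auto
    have "(M1 * Z1) $$ (i, j) = (\<Sum>l<t. (M $$ (i, l) * s l) * Z $$ (l, j)) * (1 / c j)"
      using ij unfolding sum_distrib_right
      by (subst index_mult_mat_sum) (auto simp: M1_def Z1_def intro!: sum.cong)
    also have "(\<Sum>l<t. (M $$ (i, l) * s l) * Z $$ (l, j)) = (\<Sum>l<n. (M $$ (i, l) * s l) * Z $$ (l, j))"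
      by (rule sum_lessThan_truncate[OF t, symmetric]) (use s in auto)
    also have "\<dots> = (M * mat_diag n s * Z) $$ (i, j)"
      using ij by (subst index_mult_mat_sum)
        (auto simp: mult_diag_index simp del: index_mult_mat(1) intro!: sum.cong)
    finally show "(M1 * Z1) $$ (i, j) = 1\<^sub>m t $$ (i, j)"
      using ij c0 e[OF ij(1,2)] by (simp del: index_mult_mat(1))
  qed (auto simp: M1_def Z1_def)
  then have "Z1 * M1 = 1\<^sub>m t"
    by (intro mat_mult_left_right_inverse[of M1 t]) (auto simp: M1_def Z1_def)
  then have "1 = (Z1 * M1) $$ (i, i)" using i by simp
  also have "\<dots> = (\<Sum>l<t. Z1 $$ (i, l) * M1 $$ (l, i))"
    using i by (subst index_mult_mat_sum) (auto simp: M1_def Z1_def)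
  finally show ?thesis
    using i by (auto simp: Z1_def)
qed

lemma dual_SVD_square:
  assumes "dual_SVD A t \<mu> P V" "A \<in> carrier_mat n n"
  shows "t \<le> n" "unitary_mat n P" "unitary_mat n V" "\<And>i. i < t \<Longrightarrow> dual_positive (\<mu> i)"
    "nonincreasing_duals t \<mu>"
    "A = P * mat_diag n (\<lambda>i. if i < t then \<mu> i else 0) * dagger V"
  using assms
  by (auto simp: dual_SVD_def Let_def DC_unitary_iff conj_transpose_dagger four_block_mat_diag_zero)

lemma dual_SVD_appreciable:
  assumes svd: "dual_SVD A t \<mu> P V" and A: "A \<in> carrier_mat n n"
    and Y: "Y \<in> carrier_mat n n" "A = A * A * Y" and i: "i < t"
  shows "std_part (\<mu> i) \<noteq> 0"
proof -
  note S = dual_SVD_square[OF svd A]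
  define D where "D = mat_diag n (\<lambda>i. if i < t then \<mu> i else 0)"
  note [simp] = unitary_matD(1,2)[OF S(2)] unitary_matD(1,2)[OF S(3)] carrier_matD[OF Y(1)]
  have [simp]: "dim_row D = n" "dim_col D = n" by (simp_all add: D_def)
  define M where "M = dagger V * P"
  define Z where "Z = dagger V * Y * V"
  have [simp]: "dim_row M = n" "dim_col M = n" "dim_row Z = n" "dim_col Z = n"
    by (simp_all add: M_def Z_def)
  have AD: "A = P * D * dagger V" using S(6) by (simp add: D_def)
  have "D = dagger P * A * V"
    unfolding AD by (simp add: mult_mat_assoc unitary_matD(6)[OF S(2)] unitary_matD(4)[OF S(3)])
  also have "\<dots> = dagger P * (A * A * Y) * V" using Y(2) by simp
  also have "\<dots> = D * (M * D * Z)"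
    unfolding AD by (simp add: M_def Z_def mult_mat_assoc unitary_matD(6)[OF S(2)])
  finally have DD: "D = D * (M * D * Z)" .
  have "(std_mat M * mat_diag n (\<lambda>i. if i < t then std_part (\<mu> i) else 0) * std_mat Z) $$ (i, j)
      = (if i = j then 1 else 0)" if "i < t" "j < t" for i j
  proof -
    have ij: "i < n" "j < n" using that S(1) by auto
    have "\<mu> i * (if i = j then 1 else 0) = D $$ (i, j)"
      using that ij by (simp add: D_def)
    also have "\<dots> = (D * (M * D * Z)) $$ (i, j)" using DD by simp
    also have "\<dots> = \<mu> i * (M * D * Z) $$ (i, j)"
      using that ij by (subst (1) D_def, subst diag_mult_index) auto
    \<comment> \<open>Here \<open>\<mu> i\<close> might still be infinitesimal; cancelling it
      remains valid on standard parts.\<close>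
    finally have "std_part ((M * D * Z) $$ (i, j)) = std_part (if i = j then 1 else 0)"
      using dual_positive_cancel[OF S(4)[OF that(1)]] by metis
    moreover have "std_mat (M * D * Z) = std_mat M * mat_diag n (\<lambda>i. if i < t then std_part (\<mu> i) else 0) * std_mat Z"
    proof -
      have "std_mat D = mat_diag n (\<lambda>i. if i < t then std_part (\<mu> i) else 0)"
        unfolding D_def std_mat_diag by (rule mat_diag_cong) auto
      then show ?thesis by (simp add: std_mat_mult)
    qed
    moreover have "std_mat (M * D * Z) $$ (i, j) = std_part ((M * D * Z) $$ (i, j))"
      using ij by (intro std_dual_mat_simps(5)) auto
    ultimately show ?thesis by (auto split: if_splits)
  qed
  moreover have "std_mat M \<in> carrier_mat n n" "std_mat Z \<in> carrier_mat n n"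
    by (auto intro!: carrier_matI)
  ultimately have "(if i < t then std_part (\<mu> i) else 0) \<noteq> 0"
    using diag_factor_nonzero[of "std_mat M" n "std_mat Z" t "\<lambda>i. if i < t then std_part (\<mu> i) else 0"
        "\<lambda>_. 1" i] S(1) i by simp
  then
  show ?thesis using i by auto
qed

text \<open>If \<open>t' < t\<close>, an invertible diagonal of order \<open>t\<close> would factor
  through a diagonal whose entry at index \<open>t'\<close> is zero. Applied in both directions,
  this makes the rank unique.\<close>

lemma dual_SVD_rank_le:
  assumes svd: "dual_SVD A t \<mu> P V" "dual_SVD A t' \<mu>' P' V'" and A: "A \<in> carrier_mat n n"
    and ap: "\<And>i. i < t \<Longrightarrow> std_part (\<mu> i) \<noteq> 0"
  shows "t \<le> t'"
proof (rule ccontr)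
  assume "\<not> t \<le> t'"
  then have t: "t' < t" by simp
  note S = dual_SVD_square[OF svd(1) A] and S' = dual_SVD_square[OF svd(2) A]
  define D where "D = mat_diag n (\<lambda>i. if i < t then \<mu> i else 0)"
  define D' where "D' = mat_diag n (\<lambda>i. if i < t' then \<mu>' i else 0)"
  note [simp] = unitary_matD(1,2)[OF S(2)] unitary_matD(1,2)[OF S(3)]
    unitary_matD(1,2)[OF S'(2)] unitary_matD(1,2)[OF S'(3)]
  have [simp]: "dim_row D = n" "dim_col D = n" "dim_row D' = n" "dim_col D' = n"
    by (simp_all add: D_def D'_def)
  define M where "M = dagger P * P'"
  define Z where "Z = dagger V' * V"
  have [simp]: "dim_row M = n" "dim_col M = n" "dim_row Z = n" "dim_col Z = n"
    by (simp_all add: M_def Z_def)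
  have AD: "A = P * D * dagger V" "A = P' * D' * dagger V'"
    using S(6) S'(6) by (simp_all add: D_def D'_def)
  have "D = dagger P * A * V"
    unfolding AD(1) by (simp add: mult_mat_assoc unitary_matD(6)[OF S(2)] unitary_matD(4)[OF S(3)])
  also have "\<dots> = M * D' * Z"
    unfolding AD(2) by (simp add: M_def Z_def mult_mat_assoc)
  finally have "std_mat D = std_mat M * std_mat D' * std_mat Z"
    by (simp add: std_mat_mult)
  moreover have "std_mat D' = mat_diag n (\<lambda>i. if i < t' then std_part (\<mu>' i) else 0)"
    unfolding D'_def std_mat_diag by (rule mat_diag_cong) auto
  moreover have "std_mat D = mat_diag n (\<lambda>i. if i < t then std_part (\<mu> i) else 0)"
    unfolding D_def std_mat_diag by (rule mat_diag_cong) auto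
  ultimately have eq: "std_mat M * mat_diag n (\<lambda>i. if i < t' then std_part (\<mu>' i) else 0) * std_mat Z
      = mat_diag n (\<lambda>i. if i < t then std_part (\<mu> i) else 0)" by simp
  have "(if t' < t' then std_part (\<mu>' t') else 0) \<noteq> 0"
    by (rule diag_factor_nonzero[where M = "std_mat M" and Z = "std_mat Z" and n = n and t = t
          and s = "\<lambda>i. if i < t' then std_part (\<mu>' i) else 0" and c = "\<lambda>i. std_part (\<mu> i)"])
      (use S(1) t ap in \<open>auto simp: eq\<close>)
  then show False by simp
qed

section \<open>Inverses over the dual complex numbers\<close>

lemma mult_one_imp_inverse:
  fixes K R :: "'a::comm_ring_1 mat"
  assumes K: "K \<in> carrier_mat r r" and R: "R \<in> carrier_mat r r" and KR: "K * R = 1\<^sub>m r"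
  shows "R * K = 1\<^sub>m r"
proof -
  note adj = adj_mat[OF K]
  have "det K * det R = 1" using det_mult[OF K R] KR by simp
  \<comment> \<open>In the presence of zero divisors a left inverse is built from the adjugate:
    \<open>det R\<close> inverts \<open>det K\<close>.\<close>
  define B where "B = det R \<cdot>\<^sub>m adj_mat K"
  have B: "B \<in> carrier_mat r r" using adj(1) by (auto simp: B_def)
  have "B * K = det R \<cdot>\<^sub>m (adj_mat K * K)"
    unfolding B_def by (rule mult_smult_assoc_mat[OF adj(1) K])
  also have "\<dots> = 1\<^sub>m r"
    unfolding adj(3) using \<open>det K * det R = 1\<close> by (intro eq_matI) (auto simp: mult.commute)
  finally have BK: "B * K = 1\<^sub>m r" .
  have "R = B * K * R" using BK R by simp
  also have "\<dots> = B * (K * R)" using B K R by (intro assoc_mult_mat) auto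
  also have "\<dots> = B" unfolding KR using B by simp
  finally show ?thesis using BK by simp
qed

lemma mat_inv_eq:
  assumes K: "K \<in> carrier_mat r r" and R: "R \<in> carrier_mat r r" "K * R = 1\<^sub>m r" "R * K = 1\<^sub>m r"
  shows "mat_inv K = R"
  unfolding mat_inv_def
proof (rule the_equality)
  show "inverts_mat K R \<and> inverts_mat R K" using assms by (auto simp: inverts_mat_def)
  fix B assume "inverts_mat K B \<and> inverts_mat B K"
  then have KB: "K * B = 1\<^sub>m r" and BK: "B * K = 1\<^sub>m (dim_row B)"
    using K by (auto simp: inverts_mat_def)
  have "dim_col B = r" using arg_cong[OF KB, of dim_col] by simp
  moreover have "dim_row B = r" using arg_cong[OF BK, of dim_col] K by simp
  ultimately have B: "B \<in> carrier_mat r r" by auto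
  have "B = (R * K) * B" using R B by simp
  also have "\<dots> = R * (K * B)" using B K R by (intro assoc_mult_mat) auto
  also have "\<dots> = R" unfolding KB using R by simp
  finally show "B = R" .
qed

section \<open>Uniqueness of the core inverse\<close>

lemma is_core_inverse_dagger:
  assumes "A \<in> carrier_mat n n"
  shows "is_core_inverse A X \<longleftrightarrow> X \<in> carrier_mat n n \<and> A * X * A = A \<and> A * (X * X) = X
    \<and> dagger (A * X) = A * X"
proof -
  have "X ^\<^sub>m 2 = X * X" if "X \<in> carrier_mat n n"
    using that by (simp add: numeral_2_eq_2)
  then show ?thesis using assms unfolding is_core_inverse_def conj_transpose_dagger by auto
qed

text \<open>$AX$ and $AX'$ are orthogonal projections onto the same range, hence equal; an $X = A X^2$
  is recovered from $AX$ because $A$ is left cancellable on its own range.\<close>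

lemma core_inverse_eqI:
  assumes A: "A \<in> carrier_mat n n" and X: "is_core_inverse A X"
    and W: "W \<in> carrier_mat n n" "A = W * (A * A)"
  shows "core_inverse A = X"
  unfolding core_inverse_def
proof (rule the_equality)
  show "is_core_inverse A X" by (rule X)
  fix X' assume X': "is_core_inverse A X'"
  note X = X[unfolded is_core_inverse_dagger[OF A]] and X' = X'[unfolded is_core_inverse_dagger[OF A]]
  have [simp]: "dim_row A = n" "dim_col A = n" "dim_row X = n" "dim_col X = n"
    "dim_row X' = n" "dim_col X' = n" "dim_row W = n" "dim_col W = n"
    using A X X' W by auto
  have a: "(A * X) * (A * X') = A * X'"
  proof -
    have "(A * X) * (A * X') = (A * X * A) * X'" by (simp add: mult_mat_assoc)
    then show ?thesis using X by simp
  qed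
  have b: "(A * X') * (A * X) = A * X"
  proof -
    have "(A * X') * (A * X) = (A * X' * A) * X" by (simp add: mult_mat_assoc)
    then show ?thesis using X' by simp
  qed
  have "A * X' = dagger ((A * X) * (A * X'))" unfolding a using X' by simp
  also have "\<dots> = dagger (A * X') * dagger (A * X)" by (rule dagger_mult) simp
  also have "\<dots> = A * X" using X X' b by simp
  finally have AX: "A * X' = A * X" .
  have key: "T = W * (A * T)" if "A * (T * T) = T" "dim_row T = n" "dim_col T = n" for T
  proof -
    have "W * (A * T) = W * (A * (A * (T * T)))" using that by simp
    also have "\<dots> = (W * (A * A)) * (T * T)" using that by (simp add: mult_mat_assoc)
    also have "\<dots> = A * (T * T)" by (simp flip: W(2))
    finally show ?thesis using that by simp
  qed
  have "X' = W * (A * X')" using X' by (intro key) auto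
  also have "\<dots> = W * (A * X)" unfolding AX ..
  also have "\<dots> = X" using X by (intro key[symmetric]) auto
  finally show "X' = X" .
qed

text \<open>Every column of \<open>A\<close> lies in the range of \<open>A\<close>, hence in that of
  its square; chosen preimages are the columns of \<open>Y\<close>.\<close>

lemma DC_CM_factor:
  assumes "A \<in> DC_CM n"
  obtains Y where "A \<in> carrier_mat n n" "Y \<in> carrier_mat n n" "A = A * A * Y"
proof -
  have A: "A \<in> carrier_mat n n" and rg: "range_mat (A ^\<^sub>m 2) = range_mat A"
    using assms by (auto simp: DC_CM_def)
  have A2: "A ^\<^sub>m 2 = A * A" using A by (simp add: numeral_2_eq_2)
  have AA: "A * A \<in> carrier_mat n n" using A by auto
  have "\<exists>y. y \<in> carrier_vec n \<and> (A * A) *\<^sub>v y = col A j" if "j < n" for j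
  proof -
    have "col A j = A *\<^sub>v unit_vec n j"
      using A that by (metis col_mult2 col_one one_carrier_mat right_mult_one_mat)
    then have "col A j \<in> range_mat A" using A unfolding range_mat_def by auto
    then have "col A j \<in> range_mat (A * A)" using rg A2 by simp
    then show ?thesis using AA A unfolding range_mat_def by auto
  qed
  then obtain y where y: "\<And>j. j < n \<Longrightarrow> y j \<in> carrier_vec n"
    "\<And>j. j < n \<Longrightarrow> (A * A) *\<^sub>v y j = col A j" by metis
  define Y where "Y = mat n n (\<lambda>(i, j). y j $ i)"
  have Y: "Y \<in> carrier_mat n n" by (simp add: Y_def)
  have cY: "col Y j = y j" if "j < n" for j
    using y(1)[OF that] that by (intro eq_vecI) (auto simp: Y_def)
  have "A = A * A * Y"
  proof (rule mat_col_eqI)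
    fix j assume "j < dim_col (A * A * Y)"
    then have j: "j < n" using Y by simp
    show "col A j = col (A * A * Y) j"
      unfolding col_mult2[OF AA Y j] cY[OF j] y(2)[OF j] ..
  qed (use A Y in auto)
  then show thesis using that A Y by blast
qed

section \<open>Block form and the formula for the core inverse\<close>

lemma four_block_mat_inject:
  assumes "four_block_mat A B C D = four_block_mat A' B' C' D'"
    "A \<in> carrier_mat a c" "A' \<in> carrier_mat a c" "D \<in> carrier_mat b d" "D' \<in> carrier_mat b d"
  shows "A = A'"
proof (rule eq_matI)
  fix i j assume "i < dim_row A'" "j < dim_col A'"
  then have "i < a" "j < c" using assms(3) by auto
  then have "A $$ (i, j) = four_block_mat A B C D $$ (i, j)" using assms(2,4) by auto
  also have "\<dots> = A' $$ (i, j)" unfolding assms(1) using \<open>i < a\<close> \<open>j < c\<close> assms(3,5) by auto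
  finally show "A $$ (i, j) = A' $$ (i, j)" .
qed (use assms in auto)

text \<open>With zero lower blocks, a product depends on the left factor only through its upper left
  corner. The products of \<open>N\<close>, \<open>T\<close> and \<open>J\<close> in the final proof
  reduce to this.\<close>

lemma mult_upper_blocks:
  fixes A :: "'a::comm_ring_1 mat"
  assumes "A \<in> carrier_mat r r" "B \<in> carrier_mat r m" "C \<in> carrier_mat r r" "D \<in> carrier_mat r m"
  shows "four_block_mat A B (0\<^sub>m m r) (0\<^sub>m m m) * four_block_mat C D (0\<^sub>m m r) (0\<^sub>m m m)
    = four_block_mat (A * C) (A * D) (0\<^sub>m m r) (0\<^sub>m m m)"
  by (subst mult_four_block_mat[of _ r r _ m _ m _ _ r _ m]) (use assms in auto)

theorem theorem4p10:
  fixes A :: "dual_complex mat" and n r :: nat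
  assumes "A \<in> DC_CM n"
    and "r = dual_rank A"
  shows "\<exists>U K L \<mu>.
    U \<in> DC_unitary n \<and>
    K \<in> carrier_mat r r \<and> invertible_mat K \<and>
    L \<in> carrier_mat r (n - r) \<and>
    K * conj_transpose K + L * conj_transpose L = 1\<^sub>m r \<and>
    (\<forall>i<r. dual_positive (\<mu> i) \<and> appreciable (\<mu> i)) \<and>
    nonincreasing_duals r \<mu> \<and>
    A = U * four_block_mat (mat_diag r \<mu> * K) (mat_diag r \<mu> * L)
                           (0\<^sub>m (n - r) r) (0\<^sub>m (n - r) (n - r)) * conj_transpose U \<and>
    core_inverse A =
      U * four_block_mat (mat_inv K * mat_inv (mat_diag r \<mu>)) (0\<^sub>m r (n - r))
                         (0\<^sub>m (n - r) r) (0\<^sub>m (n - r) (n - r)) * conj_transpose U"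
proof -
  obtain Y where A: "A \<in> carrier_mat n n" and Y: "Y \<in> carrier_mat n n" "A = A * A * Y"
    using DC_CM_factor[OF assms(1)] .
  obtain t \<mu> P V where svd: "dual_SVD A t \<mu> P V"
    using dual_SVD_exists[OF A Y] by blast
  have rank: "dual_rank A = t"
    unfolding dual_rank_def
  proof (rule the_equality)
    fix t' assume "\<exists>\<mu> P V. dual_SVD A t' \<mu> P V"
    then obtain \<mu>' P' V' where svd': "dual_SVD A t' \<mu>' P' V'" by blast
    show "t' = t"
      using dual_SVD_rank_le[OF svd svd' A] dual_SVD_rank_le[OF svd' svd A]
        dual_SVD_appreciable[OF svd A Y] dual_SVD_appreciable[OF svd' A Y] by force
  qed (use svd in blast)
  then have r: "r = t" using assms(2) by simp
  note S = dual_SVD_square[OF svd[folded r] A]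
  have ap: "std_part (\<mu> i) \<noteq> 0" if "i < r" for i
    using dual_SVD_appreciable[OF svd[folded r] A Y that] .
  define m where "m = n - r"
  have n: "n = r + m" using S(1) by (simp add: m_def)
  define D where "D = mat_diag n (\<lambda>i. if i < r then \<mu> i else 0)"
  note [simp] = unitary_matD(1,2)[OF S(2)] unitary_matD(1,2)[OF S(3)] carrier_matD[OF Y(1)]
  \<comment> \<open>Substituting V^* = M P^* conjugates everything by the single unitary
    \<open>P\<close> and leaves \<open>M\<close> inside; \<open>Z\<close> is \<open>Y\<close> in the
    coordinates of \<open>V\<close>.\<close>
  define M where "M = dagger V * P"
  define Z where "Z = dagger V * Y * V"
  have [simp]: "dim_row M = n" "dim_col M = n" "dim_row Z = n" "dim_col Z = n"
    "dim_row D = n" "dim_col D = n"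
    by (simp_all add: M_def Z_def D_def)
  have Mu: "unitary_mat n M"
    unfolding M_def by (rule unitary_mult[OF unitary_dagger[OF S(3)] S(2)])
  have AD: "A = P * D * dagger V" using S(6) by (simp add: D_def)
  have ADM: "A = P * (D * M) * dagger P"
    unfolding AD by (simp add: M_def mult_mat_assoc unitary_matD(3)[OF S(2)])
  have DD: "D = D * (M * D * Z)"
  proof -
    have "D = dagger P * A * V"
      unfolding AD by (simp add: mult_mat_assoc unitary_matD(6)[OF S(2)] unitary_matD(4)[OF S(3)])
    also have "\<dots> = dagger P * (A * A * Y) * V" using Y(2) by simp
    also have "\<dots> = D * (M * D * Z)"
      unfolding AD by (simp add: M_def Z_def mult_mat_assoc unitary_matD(6)[OF S(2)])
    finally show ?thesis .
  qed
  \<comment> \<open>The inverse of s + epsilon d is 1/s - epsilon d/s^2; it exists for appreciable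
    singular values.\<close>
  define \<nu> where "\<nu> i = DC (1 / std_part (\<mu> i)) (- dual_part (\<mu> i) / (std_part (\<mu> i))\<^sup>2)" for i
  have nu: "\<nu> i * \<mu> i = 1" if "i < r" for i
    using ap[OF that] by (intro dual_complex.expand) (simp add: \<nu>_def power2_eq_square)
  define K where "K = mat r r (\<lambda>(i, j). M $$ (i, j))"
  define L where "L = mat r m (\<lambda>(i, j). M $$ (i, j + r))"
  define M3 where "M3 = mat m r (\<lambda>(i, j). M $$ (i + r, j))"
  define M4 where "M4 = mat m m (\<lambda>(i, j). M $$ (i + r, j + r))"
  have c: "K \<in> carrier_mat r r" "L \<in> carrier_mat r m" "M3 \<in> carrier_mat m r" "M4 \<in> carrier_mat m m"
    by (simp_all add: K_def L_def M3_def M4_def)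
  have M_block: "M = four_block_mat K L M3 M4"
    by (rule eq_matI) (auto simp: K_def L_def M3_def M4_def n)
  define \<Sigma> where "\<Sigma> = mat_diag r \<mu>"
  define \<Sigma>i where "\<Sigma>i = mat_diag r \<nu>"
  have c\<Sigma>: "\<Sigma> \<in> carrier_mat r r" "\<Sigma>i \<in> carrier_mat r r" by (simp_all add: \<Sigma>_def \<Sigma>i_def)
  have \<Sigma>: "\<Sigma>i * \<Sigma> = 1\<^sub>m r" "\<Sigma> * \<Sigma>i = 1\<^sub>m r"
  proof -
    have "mat_diag r (\<lambda>i. \<nu> i * \<mu> i) = mat_diag r (\<lambda>_. 1)" by (rule mat_diag_cong) (rule nu)
    then show "\<Sigma>i * \<Sigma> = 1\<^sub>m r" "\<Sigma> * \<Sigma>i = 1\<^sub>m r" by (simp_all add: \<Sigma>_def \<Sigma>i_def mult.commute)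
  qed
  have D_block: "D = four_block_mat \<Sigma> (0\<^sub>m r m) (0\<^sub>m m r) (0\<^sub>m m m)"
    unfolding D_def \<Sigma>_def m_def using four_block_mat_diag_zero[OF S(1), of \<mu>] by simp
  define N where "N = four_block_mat (\<Sigma> * K) (\<Sigma> * L) (0\<^sub>m m r) (0\<^sub>m m m)"
  have DM: "D * M = N"
    unfolding D_block M_block N_def
    by (subst mult_four_block_mat[of _ r r _ m _ m _ _ r _ m]) (use c c\<Sigma> in auto)
  have KL: "K * dagger K + L * dagger L = 1\<^sub>m r"
  proof -
    have "dagger M = four_block_mat (dagger K) (dagger M3) (dagger L) (dagger M4)"
      unfolding M_block by (rule dagger_four_block[OF c])
    then have "M * dagger M = four_block_mat (K * dagger K + L * dagger L) (K * dagger M3 + L * dagger M4)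
        (M3 * dagger K + M4 * dagger L) (M3 * dagger M3 + M4 * dagger M4)"
      unfolding M_block using c
      by (subst mult_four_block_mat[of _ r r _ m _ m _ _ r _ m, symmetric]) auto
    then have "four_block_mat (K * dagger K + L * dagger L) (K * dagger M3 + L * dagger M4)
        (M3 * dagger K + M4 * dagger L) (M3 * dagger M3 + M4 * dagger M4)
      = four_block_mat (1\<^sub>m r) (0\<^sub>m r m) (0\<^sub>m m r) (1\<^sub>m m)"
      using unitary_matD(3)[OF Mu] by (simp add: four_block_one_mat n)
    then show ?thesis by (rule four_block_mat_inject[of _ _ _ _ _ _ _ _ r r m m]) (use c in auto)
  qed
  \<comment> \<open>With Z_11 the leading block of \<open>Z\<close>, the leading block of
    \<open>D = D * (M * D * Z)\<close> reads \<Sigma> = \<Sigma> K \<Sigma> Z_11. Cancelling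
    \<Sigma> on the left makes \<Sigma> Z_11, which is \<open>R\<close>, a right inverse of
    \<open>K\<close>.\<close>
  define R where "R = mat r r (\<lambda>(i, j). \<mu> i * Z $$ (i, j))"
  have R: "R \<in> carrier_mat r r" by (simp add: R_def)
  have KR: "K * R = 1\<^sub>m r"
  proof (rule eq_matI)
    fix i j assume "i < dim_row (1\<^sub>m r :: dual_complex mat)" "j < dim_col (1\<^sub>m r :: dual_complex mat)"
    then have ij: "i < r" "j < r" "i < n" "j < n" using S(1) by auto
    have "(K * R) $$ (i, j) = (\<Sum>l<r. M $$ (i, l) * (if l < r then \<mu> l else 0) * Z $$ (l, j))"
      using ij by (subst index_mult_mat_sum) (auto simp: K_def R_def mult.assoc intro!: sum.cong)
    also have "\<dots> = (\<Sum>l<n. M $$ (i, l) * (if l < r then \<mu> l else 0) * Z $$ (l, j))"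
      by (rule sum_lessThan_truncate[OF S(1), symmetric]) auto
    also have "\<dots> = (M * D * Z) $$ (i, j)"
      unfolding D_def using ij
      by (subst index_mult_mat_sum) (auto simp: mult_diag_index simp del: index_mult_mat(1) intro!: sum.cong)
    also have "\<dots> = \<nu> i * (\<mu> i * (M * D * Z) $$ (i, j))"
      using nu[OF ij(1)] by (simp flip: mult.assoc)
    also have "\<mu> i * (M * D * Z) $$ (i, j) = (D * (M * D * Z)) $$ (i, j)"
      using ij by (subst (2) D_def, subst diag_mult_index) auto
    also have "\<dots> = D $$ (i, j)" using DD by simp
    also have "\<nu> i * D $$ (i, j) = 1\<^sub>m r $$ (i, j)"
      using ij nu[OF ij(1)] by (auto simp: D_def)
    finally show "(K * R) $$ (i, j) = 1\<^sub>m r $$ (i, j)" .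
  qed (use c R in auto)
  have RK: "R * K = 1\<^sub>m r" by (rule mult_one_imp_inverse[OF c(1) R KR])
  have invK: "invertible_mat K"
    unfolding invertible_mat_def inverts_mat_def using c(1) R KR RK by (auto simp: square_mat.simps)
  have inv_eq: "mat_inv K = R" "mat_inv (mat_diag r \<mu>) = \<Sigma>i"
    using mat_inv_eq[OF c(1) R KR RK] mat_inv_eq[OF c\<Sigma> \<Sigma>(2,1)] by (simp_all add: \<Sigma>_def)
  define T where "T = four_block_mat (R * \<Sigma>i) (0\<^sub>m r m) (0\<^sub>m m r) (0\<^sub>m m m)"
  define X where "X = P * T * dagger P"
  have cc: "\<Sigma> * K \<in> carrier_mat r r" "\<Sigma> * L \<in> carrier_mat r m" "R * \<Sigma>i \<in> carrier_mat r r"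
    using c c\<Sigma> R by auto
  have GH: "(\<Sigma> * K) * (R * \<Sigma>i) = 1\<^sub>m r" "(R * \<Sigma>i) * (\<Sigma> * K) = 1\<^sub>m r"
  proof -
    note [simp] = carrier_matD[OF c(1)] carrier_matD[OF c\<Sigma>(1)] carrier_matD[OF c\<Sigma>(2)] carrier_matD[OF R]
    show "(\<Sigma> * K) * (R * \<Sigma>i) = 1\<^sub>m r"
      by (simp add: mult_mat_assoc mult_cancel_inverse[OF KR] \<Sigma>)
    show "(R * \<Sigma>i) * (\<Sigma> * K) = 1\<^sub>m r"
      by (simp add: mult_mat_assoc mult_cancel_inverse[OF \<Sigma>(1)] RK)
  qed
  have Nc: "N \<in> carrier_mat n n" "T \<in> carrier_mat n n"
    unfolding N_def T_def n using cc by auto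
  note [simp] = carrier_matD[OF Nc(1)] carrier_matD[OF Nc(2)]
  \<comment> \<open>A X in the coordinates of \<open>P\<close>: the projection onto the first
    \<open>r\<close> coordinates, visibly self-adjoint.\<close>
  define J where "J = four_block_mat (1\<^sub>m r :: dual_complex mat) (0\<^sub>m r m) (0\<^sub>m m r) (0\<^sub>m m m)"
  note [simp] = left_mult_one_mat[OF cc(1)] left_mult_one_mat[OF cc(2)] left_mult_one_mat[OF cc(3)]
    right_mult_zero_mat[OF cc(1)]
  have NT: "N * T = J"
    unfolding N_def T_def J_def using mult_upper_blocks[OF cc(1,2,3) zero_carrier_mat] GH
    by simp
  have JN: "J * N = N"
    unfolding N_def J_def using mult_upper_blocks[OF one_carrier_mat zero_carrier_mat cc(1,2)]
    by simp
  have JT: "J * T = T"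
    unfolding T_def J_def
    using mult_upper_blocks[OF one_carrier_mat zero_carrier_mat cc(3) zero_carrier_mat] by simp
  \<comment> \<open>In the coordinates of \<open>P\<close> this is A = X A^2, so \<open>X\<close>
    itself is the left multiplier that uniqueness of the core inverse asks for.\<close>
  have TNN: "T * (N * N) = N"
  proof -
    have "T * N = four_block_mat (1\<^sub>m r) (R * \<Sigma>i * (\<Sigma> * L)) (0\<^sub>m m r) (0\<^sub>m m m)"
      unfolding N_def T_def using mult_upper_blocks[OF cc(3) zero_carrier_mat cc(1,2)] GH by simp
    also have "\<dots> * N = N"
      unfolding N_def
      using mult_upper_blocks[OF one_carrier_mat mult_carrier_mat[OF cc(3,2)] cc(1,2)] by simp
    finally show ?thesis by (simp add: mult_mat_assoc)
  qed
  have Jh: "dagger J = J"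
    unfolding J_def by (subst dagger_four_block[of _ r r _ m _ m]) auto
  have Jd [simp]: "dim_row J = n" "dim_col J = n" by (simp_all add: J_def n)
  have AN: "A = P * N * dagger P" using ADM DM by simp
  have AX: "A * X = P * J * dagger P"
    unfolding AN X_def NT[symmetric] by (simp add: mult_mat_assoc unitary_matD(6)[OF S(2)])
  have Xc: "X \<in> carrier_mat n n" by (auto simp: X_def)
  have Xd [simp]: "dim_row X = n" "dim_col X = n" using Xc by auto
  have [simp]: "dim_row A = n" "dim_col A = n" using A by auto
  have "is_core_inverse A X"
    unfolding is_core_inverse_dagger[OF A]
  proof (intro conjI)
    show "X \<in> carrier_mat n n" by (rule Xc)
    have "A * X * A = P * (J * N) * dagger P"
      unfolding AX unfolding AN by (simp add: mult_mat_assoc unitary_matD(6)[OF S(2)])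
    then show "A * X * A = A" unfolding JN AN .
    have "A * (X * X) = A * X * X" by (simp add: mult_mat_assoc)
    also have "\<dots> = P * (J * T) * dagger P"
      unfolding AX unfolding X_def by (simp add: mult_mat_assoc unitary_matD(6)[OF S(2)])
    finally show "A * (X * X) = X" unfolding JT X_def .
    show "dagger (A * X) = A * X"
      unfolding AX by (simp add: dagger_mult mult_mat_assoc Jh)
  qed
  moreover have "A = X * (A * A)"
  proof -
    have "X * (A * A) = P * (T * (N * N)) * dagger P"
      unfolding AN X_def by (simp add: mult_mat_assoc unitary_matD(6)[OF S(2)])
    then show ?thesis unfolding TNN AN by simp
  qed
  ultimately have core: "core_inverse A = X"
    using core_inverse_eqI[OF A _ Xc] by blast
  show ?thesis
    unfolding conj_transpose_dagger DC_unitary_iff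
    by (rule exI[of _ P], rule exI[of _ K], rule exI[of _ L], rule exI[of _ \<mu>])
      (use S ap c invK KL AN core in
        \<open>auto simp: appreciable_def N_def T_def X_def inv_eq \<Sigma>_def m_def\<close>)
qed

end
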